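(* Let $p,q\ge0$ with $p+q>0$, and let $\{e^{t\frac12\Delta^*_{p,q}},t\ge0\}$ be the strongly continuous semigroup in $C[-\infty,+\infty]$ generated by $\frac12\Delta^*_{p,q}$ (defined in the context). Then for every $f\in C[-\infty,+\infty]$ and $t>0$, $$e^{t\frac12\Delta^*_{p,q}}f(x)=\int_{-\infty}^\infty\gamma^+_{p,q}(t,x,y)f(y)\,dy\ \ (x>0),\qquad e^{t\frac12\Delta^*_{p,q}}f(x)=\int_{-\infty}^\infty\gamma^-_{p,q}(t,x,y)f(y)\,dy\ \ (x<0),$$ where $$\gamma^+_{p,q}(t,x,y)=\begin{cases}\dfrac1{\sqrt{2\pi t}}\left(e^{-\frac{(y-x)^2}{2t}}+\dfrac{p-q}{p+q}e^{-\frac{(y+x)^2}{2t}}\right), & y>0,\\[8pt] \dfrac1{\sqrt{2\pi t}}\dfrac{2q}{p+q}e^{-\frac{(y-x)^2}{2t}}, & y<0,\end{cases}$$ $$\gamma^-_{p,q}(t,x,y)=\begin{cases}\dfrac1{\sqrt{2\pi t}}\left(e^{-\frac{(y-x)^2}{2t}}+\dfrac{q-p}{p+q}e^{-\frac{(y+x)^2}{2t}}\right), & y<0,\\[8pt] \dfrac1{\sqrt{2\pi t}}\dfrac{2p}{p+q}e^{-\frac{(y-x)^2}{2t}}, & y>0.\end{cases}$$ That is, $\gamma^{+}_{p,q}(t,x,\cdot)$ (for $x>0$) and $\gamma^-_{p,q}(t,x,\cdot)$ (for $x<0$) are the transition probability densities at time $t$, for starting point $x$, of the process governed by $\frac12\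Delta^*_{p,q}$.
   Context: $C[-\infty,+\infty]$ is the space of continuous functions on $\mathbb R$ that have finite limits at $+\infty$ and at $-\infty$, with the supremum norm. Operator $\Delta^*_{p,q}$: $f\in C[-\infty,+\infty]$ belongs to $\mathcal D(\Delta^*_{p,q})$ iff (a) $f$ is twice continuously differentiable in $(-\infty,0]$ and in $[0,\infty)$, separately, with left-hand and right-hand derivatives at $x=0$, respectively; (b) the limits $\lim_{x\to\infty}f''(x)$ and $\lim_{x\to-\infty}f''(x)$ exist and are finite; (c) $pf'(0+)=qf'(0-)$ and $f''(0+)=f''(0-)$. For such $f$, $\Delta^*_{p,q}f=f''$. $\Delta^*_{p,q}$ generates a strongly continuous bounded cosine family in $C[-\infty,+\infty]$, hence $\frac12\Delta^*_{p,q}$ generates a strongly continuous semigroup. The process $w_{p,q}(t)$, $t\ge0$, governed by $\frac12\Delta^*_{p,q}$ is the Markov process on $\mathbb R$ with $E_xf(w_{p,q}(t))=e^{t\frac12\Delta^*_{p,q}}f(x)$ for $f\in C[-\infty,+\infty]$, where $E_x$ is expectation conditional on starting at $x$. *)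

theory Defs
  imports "HOL-Probability.Probability"
begin

section \<open>The space of continuous functions with limits at both infinities\<close>

text \<open>A subspace of the bounded continuous functions, whose library norm is the supremum norm
  (boundedness is automatic for a continuous function with finite limits at both infinities).\<close>

definition cext_set :: "(real \<Rightarrow>\<^sub>C real) set" where
  "cext_set = {f. (\<exists>l. (apply_bcontfun f \<longlongrightarrow> l) at_top) \<and> (\<exists>l. (apply_bcontfun f \<longlongrightarrow> l) at_bot)}"

typedef cext = cext_set
  morphisms bcontfun_of_cext cext_of_bcontfun
  unfolding cext_set_def by (rule exI[of _ 0]) auto

setup_lifting type_definition_cext

definition cext_apply :: "cext \<Rightarrow> real \<Rightarrow> real" where
  "cext_apply f = apply_bcontfun (bcontfun_of_cext f)"

lemma cext_set_zero: "0 \<in> cext_set"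
  unfolding cext_set_def by auto

lemma cext_set_add: "f \<in> cext_set \<Longrightarrow> g \<in> cext_set \<Longrightarrow> f + g \<in> cext_set"
  unfolding cext_set_def by (fastforce intro: tendsto_add)

lemma cext_set_scaleR: "f \<in> cext_set \<Longrightarrow> a *\<^sub>R f \<in> cext_set"
  unfolding cext_set_def by (fastforce intro: tendsto_mult_left)

lemma cext_set_uminus: "f \<in> cext_set \<Longrightarrow> - f \<in> cext_set"
  using cext_set_scaleR[of f "-1"] by simp

lemma cext_set_diff: "f \<in> cext_set \<Longrightarrow> g \<in> cext_set \<Longrightarrow> f - g \<in> cext_set"
  using cext_set_add[of f "- g"] cext_set_uminus[of g] by simp

instantiation cext :: real_vector
begin

lift_definition zero_cext :: cext is 0 by (rule cext_set_zero)
lift_definition plus_cext :: "cext \<Rightarrow> cext \<Rightarrow> cext" is "(+)" by (rule cext_set_add)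
lift_definition minus_cext :: "cext \<Rightarrow> cext \<Rightarrow> cext" is "(-)" by (rule cext_set_diff)
lift_definition uminus_cext :: "cext \<Rightarrow> cext" is uminus by (rule cext_set_uminus)
lift_definition scaleR_cext :: "real \<Rightarrow> cext \<Rightarrow> cext" is scaleR by (rule cext_set_scaleR)

instance
proof
  fix a b :: real and f g h :: cext
  show "f + g + h = f + (g + h)" by transfer (simp add: add.assoc)
  show "f + g = g + f" by transfer (simp add: add.commute)
  show "0 + f = f" by transfer simp
  show "- f + f = 0" by transfer simp
  show "f - g = f + - g" by transfer simp
  show "a *\<^sub>R (f + g) = a *\<^sub>R f + a *\<^sub>R g" by transfer (simp add: scaleR_add_right)
  show "(a + b) *\<^sub>R f = a *\<^sub>R f + b *\<^sub>R f" by transfer (simp add: scaleR_add_left)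
  show "a *\<^sub>R b *\<^sub>R f = (a * b) *\<^sub>R f" by transfer simp
  show "1 *\<^sub>R f = f" by transfer simp
qed

end

instantiation cext :: real_normed_vector
begin

lift_definition norm_cext :: "cext \<Rightarrow> real" is norm .

definition dist_cext :: "cext \<Rightarrow> cext \<Rightarrow> real" where
  "dist_cext f g = norm (f - g)"

definition sgn_cext :: "cext \<Rightarrow> cext" where
  "sgn_cext f = f /\<^sub>R norm f"

definition uniformity_cext :: "(cext \<times> cext) filter" where
  "uniformity_cext = (INF e\<in>{0 <..}. principal {(f, g). dist f g < e})"

definition open_cext :: "cext set \<Rightarrow> bool" where
  "open_cext S = (\<forall>f\<in>S. \<forall>\<^sub>F (f', g) in uniformity. f' = f \<longrightarrow> g \<in> S)"

instance
proof
  fix a :: real and f g :: cext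
  show "norm f = 0 \<longleftrightarrow> f = 0" by transfer simp
  show "norm (f + g) \<le> norm f + norm g" by transfer (rule norm_triangle_ineq)
  show "norm (a *\<^sub>R f) = \<bar>a\<bar> * norm f" by transfer simp
qed (simp_all add: dist_cext_def sgn_cext_def uniformity_cext_def open_cext_def)

end

lemma closed_cext_set: "closed cext_set"
proof -
  have limit_at: "\<exists>b. (apply_bcontfun g \<longlongrightarrow> b) F"
    if F: "F \<noteq> bot" and lim: "f \<longlonglongrightarrow> g"
      and ex: "\<And>n. \<exists>b. (apply_bcontfun (f n) \<longlongrightarrow> b) F"
    for F :: "real filter" and f and g :: "real \<Rightarrow>\<^sub>C real"
  proof -
    obtain b where b: "\<And>n. (apply_bcontfun (f n) \<longlongrightarrow> b n) F"
      using ex by metis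
    have b_dist: "dist (b m) (b n) \<le> dist (f m) (f n)" for m n
      by (rule tendsto_upperbound[OF tendsto_dist[OF b b]]) (auto simp: F dist_bounded)
    have "Cauchy b"
    proof (rule metric_CauchyI)
      fix e :: real assume "e > 0"
      then obtain M where "\<forall>m\<ge>M. \<forall>n\<ge>M. dist (f m) (f n) < e"
        using metric_CauchyD[OF LIMSEQ_imp_Cauchy[OF lim]] by blast
      then show "\<exists>M. \<forall>m\<ge>M. \<forall>n\<ge>M. dist (b m) (b n) < e"
        using b_dist le_less_trans by blast
    qed
    then obtain c where c: "b \<longlonglongrightarrow> c"
      using Cauchy_convergent convergent_def by blast
    have "(apply_bcontfun g \<longlongrightarrow> c) F"
    proof (rule tendstoI)
      fix e :: real assume "e > 0"
      then have e3: "e / 3 > 0" by simp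
      have "\<forall>\<^sub>F n in sequentially. dist (f n) g < e / 3 \<and> dist (b n) c < e / 3"
        using tendstoD[OF lim e3] tendstoD[OF c e3] by (rule eventually_conj)
      then obtain n where n: "dist (f n) g < e / 3" "dist (b n) c < e / 3"
        using eventually_happens' sequentially_bot by blast
      show "\<forall>\<^sub>F x in F. dist (apply_bcontfun g x) c < e"
        using tendstoD[OF b[of n] e3]
      proof eventually_elim
        case (elim x)
        have "dist (apply_bcontfun (f n) x) (apply_bcontfun g x) < e / 3"
          using dist_bounded[of "f n" x g] n(1) by linarith
        then show ?case
          using elim n(2) unfolding dist_real_def by linarith
      qed
    qed
    then show ?thesis ..
  qed
  show ?thesis
    unfolding closed_sequential_limits
  proof (intro allI impI, elim conjE)
    fix f :: "nat \<Rightarrow> real \<Rightarrow>\<^sub>C real" and g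
    assume f: "\<forall>n. f n \<in> cext_set" and lim: "f \<longlonglongrightarrow> g"
    have "\<exists>b. (apply_bcontfun g \<longlongrightarrow> b) at_top"
      by (rule limit_at[OF _ lim]) (use f in \<open>auto simp: cext_set_def\<close>)
    moreover have "\<exists>b. (apply_bcontfun g \<longlongrightarrow> b) at_bot"
      by (rule limit_at[OF _ lim]) (use f in \<open>auto simp: cext_set_def\<close>)
    ultimately show "g \<in> cext_set"
      unfolding cext_set_def by blast
  qed
qed

instance cext :: banach
proof
  fix f :: "nat \<Rightarrow> cext"
  assume f: "Cauchy f"
  have dist_eq: "dist x y = dist (bcontfun_of_cext x) (bcontfun_of_cext y)" for x y
    by (simp add: dist_norm norm_cext.rep_eq minus_cext.rep_eq)
  have "Cauchy (\<lambda>n. bcontfun_of_cext (f n))"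
    using f unfolding Cauchy_def dist_eq .
  then obtain g where g: "(\<lambda>n. bcontfun_of_cext (f n)) \<longlonglongrightarrow> g"
    using Cauchy_convergent convergent_def by blast
  have "g \<in> cext_set"
    by (rule closed_sequentially[OF closed_cext_set _ g]) (rule bcontfun_of_cext)
  then have "f \<longlonglongrightarrow> cext_of_bcontfun g"
    using g unfolding tendsto_iff dist_eq by (simp add: cext_of_bcontfun_inverse)
  then show "convergent f"
    by (rule convergentI)
qed

lemma cext_apply_continuous: "continuous_on S (cext_apply f)"
  unfolding cext_apply_def by simp

lemma cext_apply_eqI: "(\<And>x. cext_apply f x = cext_apply g x) \<Longrightarrow> f = g"
  unfolding cext_apply_def by (simp add: bcontfun_eqI bcontfun_of_cext_inject[symmetric])

lemma cext_apply_simps [simp]: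
  "cext_apply 0 x = 0"
  "cext_apply (f + g) x = cext_apply f x + cext_apply g x"
  "cext_apply (f - g) x = cext_apply f x - cext_apply g x"
  "cext_apply (- f) x = - cext_apply f x"
  "cext_apply (a *\<^sub>R f) x = a * cext_apply f x"
  unfolding cext_apply_def
  by (simp_all add: zero_cext.rep_eq plus_cext.rep_eq minus_cext.rep_eq uminus_cext.rep_eq
      scaleR_cext.rep_eq)

lemma norm_cext_eq_Sup: "norm f = (SUP x. \<bar>cext_apply f x\<bar>)"
  unfolding cext_apply_def norm_cext.rep_eq norm_bcontfun_def
  by (simp add: dist_bcontfun.rep_eq)

lemma cext_apply_limits:
  "\<exists>l. (cext_apply f \<longlongrightarrow> l) at_top" "\<exists>l. (cext_apply f \<longlongrightarrow> l) at_bot"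
  using bcontfun_of_cext[of f] unfolding cext_set_def cext_apply_def by auto

lemma cext_exists:
  assumes cont: "continuous_on UNIV g"
    and top: "(g \<longlongrightarrow> a) at_top" and bot: "(g \<longlongrightarrow> b) at_bot"
  obtains f where "cext_apply f = g"
proof -
  obtain M where M: "\<And>x. x \<ge> M \<Longrightarrow> dist (g x) a < 1"
    using tendstoD[OF top zero_less_one] unfolding eventually_at_top_linorder by blast
  obtain m where m: "\<And>x. x \<le> m \<Longrightarrow> dist (g x) b < 1"
    using tendstoD[OF bot zero_less_one] unfolding eventually_at_bot_linorder by blast
  have "compact (g ` {m..M})"
    by (rule compact_continuous_image[OF continuous_on_subset[OF cont]]) auto
  then have "bounded (cball a 1 \<union> cball b 1 \<union> g ` {m..M})"
    by (simp add: compact_imp_bounded)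
  moreover have "range g \<subseteq> cball a 1 \<union> cball b 1 \<union> g ` {m..M}"
  proof
    fix y assume "y \<in> range g"
    then obtain x where "y = g x" by blast
    then show "y \<in> cball a 1 \<union> cball b 1 \<union> g ` {m..M}"
      using M[of x] m[of x] by (cases "x \<ge> M"; cases "x \<le> m") (auto simp: dist_commute)
  qed
  ultimately have "g \<in> bcontfun"
    using cont bounded_subset unfolding bcontfun_def by blast
  then obtain h where h: "apply_bcontfun h = g"
    by (metis bcontfunE)
  have "h \<in> cext_set" unfolding cext_set_def using top bot h by auto
  then have "cext_apply (cext_of_bcontfun h) = g"
    unfolding cext_apply_def using h by (simp add: cext_of_bcontfun_inverse)
  then show thesis by (rule that)
qed

section \<open>One-parameter semigroups and generators\<close>

definition strongly_continuous_semigroup :: "(real \<Rightarrow> 'a::real_normed_vector \<Rightarrow>\<^sub>L 'a) \<Rightarrow> bool" where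
  "strongly_continuous_semigroup T \<longleftrightarrow>
     T 0 = id_blinfun \<and>
     (\<forall>s\<ge>0. \<forall>t\<ge>0. T (s + t) = T s o\<^sub>L T t) \<and>
     (\<forall>f. continuous_on {0..} (\<lambda>t. blinfun_apply (T t) f))"

text \<open>Unbounded operators are represented by their graphs.\<close>

definition generator :: "(real \<Rightarrow> 'a::real_normed_vector \<Rightarrow>\<^sub>L 'a) \<Rightarrow> ('a \<times> 'a) set" where
  "generator T = {(f, g). ((\<lambda>h. (blinfun_apply (T h) f - f) /\<^sub>R h) \<longlongrightarrow> g) (at_right 0)}"

definition generates :: "('a::real_normed_vector \<times> 'a) set \<Rightarrow> (real \<Rightarrow> 'a \<Rightarrow>\<^sub>L 'a) \<Rightarrow> bool" where
  "generates A T \<longleftrightarrow> strongly_continuous_semigroup T \<and> generator T = A"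

definition scale_operator :: "real \<Rightarrow> ('a::real_vector \<times> 'a) set \<Rightarrow> ('a \<times> 'a) set" where
  "scale_operator c A = {(f, c *\<^sub>R g) |f g. (f, g) \<in> A}"

section \<open>The operator with transmission conditions at zero\<close>

text \<open>At the endpoint of a half-line this is the one-sided derivative.\<close>

definition deriv_on :: "real set \<Rightarrow> (real \<Rightarrow> real) \<Rightarrow> real \<Rightarrow> real" where
  "deriv_on S f x = vector_derivative f (at x within S)"

definition C2_on :: "real set \<Rightarrow> (real \<Rightarrow> real) \<Rightarrow> bool" where
  "C2_on S f \<longleftrightarrow>
     f differentiable_on S \<and> deriv_on S f differentiable_on S \<and>
     continuous_on S (deriv_on S (deriv_on S f))"

definition delta_star_domain :: "real \<Rightarrow> real \<Rightarrow> cext set" where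
  "delta_star_domain p q = {f.
     C2_on {..0} (cext_apply f) \<and> C2_on {0..} (cext_apply f) \<and>
     (\<exists>l. (deriv_on {0..} (deriv_on {0..} (cext_apply f)) \<longlongrightarrow> l) at_top) \<and>
     (\<exists>l. (deriv_on {..0} (deriv_on {..0} (cext_apply f)) \<longlongrightarrow> l) at_bot) \<and>
     p * deriv_on {0..} (cext_apply f) 0 = q * deriv_on {..0} (cext_apply f) 0 \<and>
     deriv_on {0..} (deriv_on {0..} (cext_apply f)) 0
       = deriv_on {..0} (deriv_on {..0} (cext_apply f)) 0}"

definition delta_star :: "real \<Rightarrow> real \<Rightarrow> (cext \<times> cext) set" where
  "delta_star p q = {(f, g). f \<in> delta_star_domain p q \<and>
     (\<forall>x\<ge>0. cext_apply g x = deriv_on {0..} (deriv_on {0..} (cext_apply f)) x) \<and>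
     (\<forall>x\<le>0. cext_apply g x = deriv_on {..0} (deriv_on {..0} (cext_apply f)) x)}"

lemma delta_star_functional:
  assumes "(f, g) \<in> delta_star p q" "(f, h) \<in> delta_star p q"
  shows "g = h"
proof (rule cext_apply_eqI)
  fix x show "cext_apply g x = cext_apply h x"
    using assms unfolding delta_star_def by (cases "x \<ge> 0") auto
qed

lemma Domain_delta_star: "Domain (delta_star p q) = delta_star_domain p q"
proof (intro equalityI subsetI)
  fix f assume "f \<in> Domain (delta_star p q)"
  then show "f \<in> delta_star_domain p q" unfolding delta_star_def by auto
next
  fix f assume f: "f \<in> delta_star_domain p q"
  define r where "r = deriv_on {0..} (deriv_on {0..} (cext_apply f))"
  define l where "l = deriv_on {..0} (deriv_on {..0} (cext_apply f))"
  define g where "g = (\<lambda>x. if x \<le> 0 then l x else r x)"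
  have cl: "continuous_on {..0} l" and cr: "continuous_on {0..} r" and eq: "r 0 = l 0"
    using f unfolding delta_star_domain_def C2_on_def l_def r_def by auto
  obtain a b where a: "(r \<longlongrightarrow> a) at_top" and b: "(l \<longlongrightarrow> b) at_bot"
    using f unfolding delta_star_domain_def l_def r_def by auto
  have "continuous_on ({..0} \<union> {0..}) g"
    unfolding g_def
    by (rule continuous_on_cases) (use cl cr eq in auto)
  moreover have "{..0} \<union> {0..} = (UNIV :: real set)" by auto
  ultimately have "continuous_on UNIV g" by simp
  moreover have "(g \<longlongrightarrow> a) at_top"
  proof (rule Lim_transform_eventually[OF a])
    show "\<forall>\<^sub>F x in at_top. r x = g x"
      using eventually_gt_at_top[of 0] by eventually_elim (auto simp: g_def)
  qed
  moreover have "(g \<longlongrightarrow> b) at_bot"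
  proof (rule Lim_transform_eventually[OF b])
    show "\<forall>\<^sub>F x in at_bot. l x = g x"
      using eventually_le_at_bot[of 0] by eventually_elim (auto simp: g_def)
  qed
  ultimately obtain h where h: "cext_apply h = g"
    by (rule cext_exists)
  have "(f, h) \<in> delta_star p q"
    unfolding delta_star_def using f h eq by (auto simp: g_def l_def r_def)
  then show "f \<in> Domain (delta_star p q)" by blast
qed

section \<open>Markov processes\<close>

definition natural_filtration :: "'w measure \<Rightarrow> (real \<Rightarrow> 'w \<Rightarrow> real) \<Rightarrow> real \<Rightarrow> 'w measure" where
  "natural_filtration M w s =
     sigma (space M) {w r -` B \<inter> space M |r B. 0 \<le> r \<and> r \<le> s \<and> B \<in> sets borel}"

text \<open>A time-homogeneous Markov process on the real line: a process with one law on the common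
  sample space for each starting point, all having the same transition probabilities.\<close>

definition markov_process :: "(real \<Rightarrow> 'w measure) \<Rightarrow> (real \<Rightarrow> 'w \<Rightarrow> real) \<Rightarrow> bool" where
  "markov_process P w \<longleftrightarrow>
     (\<forall>x. prob_space (P x)) \<and>
     (\<forall>x y. sets (P x) = sets (P y)) \<and>
     (\<forall>x. \<forall>t\<ge>0. w t \<in> borel_measurable (P x)) \<and>
     (\<forall>x. AE \<omega> in P x. w 0 \<omega> = x) \<and>
     (\<forall>t\<ge>0. \<forall>B\<in>sets borel. (\<lambda>x. measure (P x) (w t -` B \<inter> space (P x))) \<in> borel_measurable borel) \<and>
     (\<forall>x. \<forall>s\<ge>0. \<forall>t\<ge>0. \<forall>B\<in>sets borel. AE \<omega> in P x.
        real_cond_exp (P x) (natural_filtration (P x) w s) (\<lambda>\<omega>'. indicator B (w (s + t) \<omega>')) \<omega>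
          = measure (P (w s \<omega>)) (w t -` B \<inter> space (P (w s \<omega>))))"

definition governed_by ::
  "(real \<Rightarrow> 'w measure) \<Rightarrow> (real \<Rightarrow> 'w \<Rightarrow> real) \<Rightarrow> (real \<Rightarrow> cext \<Rightarrow>\<^sub>L cext) \<Rightarrow> bool" where
  "governed_by P w T \<longleftrightarrow> markov_process P w \<and>
     (\<forall>f x. \<forall>t\<ge>0. (\<integral>\<omega>. cext_apply f (w t \<omega>) \<partial>P x) = cext_apply (blinfun_apply (T t) f) x)"

section \<open>The kernels\<close>

text \<open>The value at \<open>y = 0\<close>, which the formulas leave open, is set to zero.\<close>

definition gamma_plus :: "real \<Rightarrow> real \<Rightarrow> real \<Rightarrow> real \<Rightarrow> real \<Rightarrow> real" where
  "gamma_plus p q t x y =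
     (if y > 0 then 1 / sqrt (2 * pi * t) *
        (exp (- ((y - x)\<^sup>2 / (2 * t))) + (p - q) / (p + q) * exp (- ((y + x)\<^sup>2 / (2 * t))))
      else if y < 0 then 1 / sqrt (2 * pi * t) * (2 * q / (p + q)) * exp (- ((y - x)\<^sup>2 / (2 * t)))
      else 0)"

definition gamma_minus :: "real \<Rightarrow> real \<Rightarrow> real \<Rightarrow> real \<Rightarrow> real \<Rightarrow> real" where
  "gamma_minus p q t x y =
     (if y < 0 then 1 / sqrt (2 * pi * t) *
        (exp (- ((y - x)\<^sup>2 / (2 * t))) + (q - p) / (p + q) * exp (- ((y + x)\<^sup>2 / (2 * t))))
      else if y > 0 then 1 / sqrt (2 * pi * t) * (2 * p / (p + q)) * exp (- ((y - x)\<^sup>2 / (2 * t)))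
      else 0)"

end

(* For x > 0, extend f restricted to the right half-line to the left one by
   a f(-y) + (1 - a) f(y) with a = (p - q)/(p + q); the transmission conditions say exactly that this
   extension of a function in the domain is C^2 on the whole line. Hence the extension v(s) of T(s) f
   solves the heat equation v' = v_xx / 2, and s |-> (H_(t-s) v(s))(x), with H the Gaussian semigroup,
   is continuous with vanishing right derivative, by the semigroup property of H and a second-order
   Taylor expansion. Comparing s = 0 with s = t gives T(t) f on the half-line for f in the domain, and
   density gives it for all f. Folding the Gaussian integral over y < 0 back by reflection produces
   the kernel; x < 0 is the mirror image with p and q exchanged. The laws are then determined by
   integrals of continuous step functions. *)
theory Submission
  imports Defs
begin

section \<open>A mean value principle for right derivatives\<close>

text \<open>For each slope \<open>e > 0\<close> the set of times at which \<open>f\<close> has moved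
  by at most \<open>e * (s - a)\<close> is closed, so it contains its supremum. The estimate to the
  right of a supremum below \<open>b\<close> would produce a larger member; hence the supremum is
  \<open>b\<close>, and \<open>e\<close> tends to 0.\<close>

lemma constant_if_right_derivative_zero:
  fixes f :: "real \<Rightarrow> 'a::real_normed_vector"
  assumes "a \<le> b" and cont: "continuous_on {a..b} f"
    and right: "\<And>s e. \<lbrakk>a \<le> s; s < b; e > 0\<rbrakk> \<Longrightarrow> \<forall>\<^sub>F r in at_right s. norm (f r - f s) \<le> e * (r - s)"
  shows "f b = f a"
proof -
  have bound: "norm (f b - f a) \<le> e * (b - a)" if "e > 0" for e
  proof -
    define S where "S = {s \<in> {a..b}. norm (f s - f a) \<le> e * (s - a)}"
    have "closed S"
      unfolding S_def
      by (intro continuous_on_closed_Collect_le continuous_intros cont closed_atLeastAtMost)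
    moreover have ne: "S \<noteq> {}" and bdd: "bdd_above S"
      using \<open>a \<le> b\<close> by (auto simp: S_def intro!: exI[of _ a] bdd_aboveI[of _ b])
    ultimately have mem: "Sup S \<in> S"
      by (intro closed_contains_Sup)
    have "\<not> Sup S < b"
    proof
      assume less: "Sup S < b"
      have "\<forall>\<^sub>F r in at_right (Sup S). norm (f r - f (Sup S)) \<le> e * (r - Sup S)"
        using mem less \<open>e > 0\<close> by (intro right) (auto simp: S_def)
      then have "\<forall>\<^sub>F r in at_right (Sup S). r \<in> S \<and> r > Sup S"
        using eventually_at_right_less[of "Sup S"] eventually_at_right_real[OF less]
      proof eventually_elim
        case (elim r)
        have "norm (f r - f a) \<le> norm (f r - f (Sup S)) + norm (f (Sup S) - f a)"
          using norm_triangle_ineq[of "f r - f (Sup S)" "f (Sup S) - f a"] by simp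
        also have "\<dots> \<le> e * (r - Sup S) + e * (Sup S - a)"
          using elim mem by (auto simp: S_def)
        finally have "norm (f r - f a) \<le> e * (r - a)"
          by (simp add: algebra_simps)
        then show ?case
          using elim mem by (auto simp: S_def)
      qed
      then obtain r where "r \<in> S" "r > Sup S"
        using eventually_happens' trivial_limit_at_right_real by blast
      then show False
        using cSup_upper[OF _ bdd] by fastforce
    qed
    then have "Sup S = b" using mem by (auto simp: S_def)
    then show ?thesis using mem by (simp add: S_def)
  qed
  have "norm (f b - f a) \<le> 0"
  proof (cases "a = b")
    case False
    with \<open>a \<le> b\<close> have "b - a > 0" by simp
    show ?thesis
    proof (rule field_le_epsilon)
      fix e :: real assume "e > 0"
      with bound[of "e / (b - a)"] \<open>b - a > 0\<close> show "norm (f b - f a) \<le> 0 + e" by simp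
    qed
  qed simp
  then show ?thesis by simp
qed

section \<open>The Gaussian semigroup and the heat equation on the line\<close>

text \<open>The Gaussian semigroup as an expectation over one fixed standard normal variable: time 0
  is then the identity without a case distinction, and only fixed moments occur in the
  expansions.\<close>

definition heat :: "real \<Rightarrow> (real \<Rightarrow> real) \<Rightarrow> real \<Rightarrow> real" where
  "heat t g x = (\<integral>z. g (x + sqrt t * z) \<partial>std_normal_distribution)"

interpretation std_normal: real_distribution std_normal_distribution
  by (rule real_dist_normal_dist)

lemma prob_std_normal_UNIV [simp]: "measure std_normal_distribution UNIV = 1"
  using std_normal.prob_space by simp

lemma integrable_heat:
  fixes g :: "real \<Rightarrow> real"
  assumes [measurable]: "g \<in> borel_measurable borel" and "\<And>y. \<bar>g y\<bar> \<le> B"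
  shows "integrable std_normal_distribution (\<lambda>z. g (x + sqrt t * z))"
  by (rule std_normal.integrable_const_bound[of _ B]) (use assms in auto)

lemma heat_0 [simp]: "heat 0 g x = g x"
  by (simp add: heat_def)

lemma heat_diff:
  assumes "f \<in> borel_measurable borel" "\<And>y. \<bar>f y\<bar> \<le> B"
    and "g \<in> borel_measurable borel" "\<And>y. \<bar>g y\<bar> \<le> C"
  shows "heat t (\<lambda>y. f y - g y) x = heat t f x - heat t g x"
  unfolding heat_def
  by (rule Bochner_Integration.integral_diff; rule integrable_heat; fact)

lemma abs_heat_le:
  assumes [measurable]: "g \<in> borel_measurable borel" and B: "\<And>y. \<bar>g y\<bar> \<le> B"
  shows "\<bar>heat t g x\<bar> \<le> B"
proof -
  have "\<bar>heat t g x\<bar> \<le> (\<integral>z. \<bar>g (x + sqrt t * z)\<bar> \<partial>std_normal_distribution)"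
    unfolding heat_def by (rule integral_abs_bound)
  also have "\<dots> \<le> (\<integral>z. B \<partial>std_normal_distribution)"
    using integrable_heat[OF assms] B by (intro integral_mono) auto
  finally show ?thesis by simp
qed

lemma scaled_std_normal:
  assumes "s > 0"
  shows "distr std_normal_distribution borel (\<lambda>z. s * z) = density lborel (normal_density 0 s)"
proof -
  have "distributed std_normal_distribution lborel (\<lambda>z. z) std_normal_density"
    unfolding distributed_def by (simp add: distr_id2)
  from std_normal.normal_density_affine[OF this, of s 0] assms
  have "distributed std_normal_distribution lborel (\<lambda>z. s * z) (normal_density 0 s)"
    by simp
  moreover have "distr std_normal_distribution borel (\<lambda>z. s * z)
      = distr std_normal_distribution lborel (\<lambda>z. s * z)"
    by (rule distr_cong) auto
  ultimately show ?thesis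
    unfolding distributed_def by simp
qed

lemma heat_eq_density:
  assumes "t > 0" and [measurable]: "g \<in> borel_measurable borel"
  shows "heat t g x = (\<integral>y. g (x + y) \<partial>density lborel (normal_density 0 (sqrt t)))"
  unfolding heat_def using assms(1)
  by (subst scaled_std_normal[symmetric]) (auto simp: integral_distr)

text \<open>Variances of independent centred normals add: the deviations \<open>sqrt s\<close> and
  \<open>sqrt t\<close> combine to \<open>sqrt (s + t)\<close>.\<close>

lemma normal_convolution:
  assumes "s > 0" "t > 0"
  shows "density lborel (normal_density 0 (sqrt s)) \<star> density lborel (normal_density 0 (sqrt t))
    = density lborel (normal_density 0 (sqrt (s + t)))"
proof -
  have fin: "finite_measure (density lborel (normal_density 0 (sqrt r)))" if "r > 0" for r
    using prob_space_normal_density[of "sqrt r" 0] that by (simp add: prob_space_def)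
  have "(\<lambda>x. \<integral>\<^sup>+y. ennreal (normal_density 0 (sqrt s) (x - y)) * ennreal (normal_density 0 (sqrt t) y) \<partial>lborel)
     = (\<lambda>x. ennreal (normal_density 0 (sqrt (s + t)) x))"
    using conv_normal_density_zero_mean[of "sqrt s" "sqrt t"] assms by (simp add: ennreal_mult')
  then show ?thesis
    by (subst convolution_density) (auto simp: fin assms)
qed

text \<open>By Fubini the iterated expectation is an integral over a product measure, whose image
  under addition is the convolution of the two normal laws.\<close>

lemma heat_heat:
  assumes "s \<ge> 0" "t \<ge> 0" and [measurable]: "g \<in> borel_measurable borel" and B: "\<And>y. \<bar>g y\<bar> \<le> B"
  shows "heat s (heat t g) x = heat (s + t) g x"
\<comment> \<open>At time zero the law is a point mass without a density, so this case is treated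
  apart.\<close>
proof (cases "s = 0 \<or> t = 0")
  case True
  then show ?thesis by (auto simp: heat_def)
next
  case False
  with assms have s: "s > 0" and t: "t > 0" by auto
  let ?S = "density lborel (normal_density 0 (sqrt s))"
  let ?T = "density lborel (normal_density 0 (sqrt t))"
  interpret S: prob_space ?S using s by (intro prob_space_normal_density) auto
  interpret T: prob_space ?T using t by (intro prob_space_normal_density) auto
  interpret ST: pair_prob_space ?S ?T ..
  have meas: "heat t g \<in> borel_measurable borel"
    unfolding heat_def by measurable
  have "heat s (heat t g) x = (\<integral>y. heat t g (x + y) \<partial>?S)"
    using s meas by (rule heat_eq_density)
  also have "\<dots> = (\<integral>y. (\<integral>z. g (x + y + z) \<partial>?T) \<partial>?S)"
    using t by (simp add: heat_eq_density)
  also have "\<dots> = (\<integral>w. g (x + fst w + snd w) \<partial>(?S \<Otimes>\<^sub>M ?T))"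
  proof -
    have "integrable (?S \<Otimes>\<^sub>M ?T) (\<lambda>w. g (x + fst w + snd w))"
      by (rule ST.P.integrable_const_bound[of _ B]) (use B in auto)
    from ST.integral_fst'[OF this] show ?thesis by simp
  qed
  also have "\<dots> = (\<integral>w. g (x + w) \<partial>(?S \<star> ?T))"
    unfolding convolution_def
    by (subst integral_distr) (auto simp: split_beta add.assoc)
  also have "\<dots> = heat (s + t) g x"
    using s t by (simp add: normal_convolution heat_eq_density)
  finally show ?thesis .
qed

section \<open>Gaussian moments and small-time expansions\<close>

text \<open>Against the standard normal, 1, z, z^2 and z^4 integrate to 1, 0, 1 and 3. The linear
  term therefore drops out, and the error bound integrates to \<open>D + 3 * E\<close>.\<close>

lemma std_normal_quartic_estimate:
  assumes F: "integrable std_normal_distribution F"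
    and bound: "\<And>z. \<bar>F z - (A + B * z + C * z\<^sup>2)\<bar> \<le> D * z\<^sup>2 + E * z ^ 4"
  shows "\<bar>(\<integral>z. F z \<partial>std_normal_distribution) - (A + C)\<bar> \<le> D + 3 * E"
proof -
  let ?N = std_normal_distribution
  have i2: "integrable ?N (\<lambda>z. z\<^sup>2)" and i4: "integrable ?N (\<lambda>z. z ^ 4)" and i1: "integrable ?N (\<lambda>z. z)"
    using integrable_std_normal_distribution_moment[of 2] integrable_std_normal_distribution_moment[of 4]
      integrable_std_normal_distribution_moment[of 1] by auto
  have m2: "(\<integral>z. z\<^sup>2 \<partial>?N) = 1"
    using std_normal_distribution_even_moments(1)[of 1] by (simp add: fact_numeral)
  have m4: "(\<integral>z. z ^ 4 \<partial>?N) = 3"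
    using std_normal_distribution_even_moments(1)[of 2] by (simp add: fact_numeral)
  have m1: "(\<integral>z. z \<partial>?N) = 0"
    using integral_std_normal_distribution_moment_odd[of 1] by simp
  have P: "integrable ?N (\<lambda>z. A + B * z + C * z\<^sup>2)"
    using i1 i2 by (intro Bochner_Integration.integrable_add integrable_mult_right) auto
  have Q: "integrable ?N (\<lambda>z. D * z\<^sup>2 + E * z ^ 4)"
    using i2 i4 by (intro Bochner_Integration.integrable_add integrable_mult_right) auto
  have "(\<integral>z. A + B * z + C * z\<^sup>2 \<partial>?N) = A + B * 0 + C * 1"
    using i1 i2 by (subst Bochner_Integration.integral_add, simp, simp)+ (simp add: m1 m2)
  then have "\<bar>(\<integral>z. F z \<partial>?N) - (A + C)\<bar> = \<bar>\<integral>z. F z - (A + B * z + C * z\<^sup>2) \<partial>?N\<bar>"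
    using Bochner_Integration.integral_diff[OF F P] by simp
  also have "\<dots> \<le> (\<integral>z. \<bar>F z - (A + B * z + C * z\<^sup>2)\<bar> \<partial>?N)"
    by (rule integral_abs_bound)
  also have "\<dots> \<le> (\<integral>z. D * z\<^sup>2 + E * z ^ 4 \<partial>?N)"
    using bound by (intro integral_mono Q integrable_abs Bochner_Integration.integrable_diff[OF F P])
  also have "\<dots> = D + 3 * E"
    using i2 i4 by (subst Bochner_Integration.integral_add) (simp_all add: m2 m4)
  finally show ?thesis .
qed

lemma taylor_two:
  assumes "\<And>y. (g has_real_derivative g1 y) (at y)" "\<And>y. (g1 has_real_derivative g2 y) (at y)"
  obtains r where "\<bar>r - x\<bar> \<le> \<bar>z\<bar>" "g (x + z) = g x + g1 x * z + g2 r / 2 * z\<^sup>2"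
proof (cases "z = 0")
  case True
  then show ?thesis using that[of x] by simp
next
  case False
  \<comment> \<open>The sequence of derivatives in the format that \<open>Taylor\<close> expects;
    only the indices 0, 1 and 2 matter.\<close>
  define diff where "diff m = (if m = 0 then g else if m = 1 then g1 else g2)" for m :: nat
  have "\<exists>r. (if x + z < x then x + z < r \<and> r < x else x < r \<and> r < x + z) \<and>
    g (x + z) = (\<Sum>m<2. (diff m x / fact m) * (x + z - x) ^ m) + (diff 2 r / fact 2) * (x + z - x) ^ 2"
    by (rule Taylor[of 2 diff g "min x (x + z)" "max x (x + z)"])
       (use False assms in \<open>auto simp: diff_def less_2_cases_iff\<close>)
  then obtain r where "if x + z < x then x + z < r \<and> r < x else x < r \<and> r < x + z"
      "g (x + z) = g x + g1 x * z + g2 r / 2 * z\<^sup>2"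
    by (auto simp: diff_def numeral_2_eq_2)
  then show ?thesis
    by (intro that[of r]) (auto split: if_splits)
qed

text \<open>Crude version of the expansion, with the whole second-order remainder put into the error
  term; it serves to prove continuity in time.\<close>

lemma heat_estimate:
  assumes g: "g \<in> borel_measurable borel" "\<And>y. \<bar>g y\<bar> \<le> B"
    and d1: "\<And>y. (g has_real_derivative g1 y) (at y)"
    and d2: "\<And>y. (g1 has_real_derivative g2 y) (at y)"
    and M: "\<And>y. \<bar>g2 y\<bar> \<le> M" and "h \<ge> 0"
  shows "\<bar>heat h g x - g x\<bar> \<le> M / 2 * h"
proof -
  have "\<bar>g (x + sqrt h * z) - (g x + (g1 x * sqrt h) * z + 0 * z\<^sup>2)\<bar> \<le> (M / 2 * h) * z\<^sup>2 + 0 * z ^ 4" for z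
  proof -
    obtain r where r: "g (x + sqrt h * z) = g x + g1 x * (sqrt h * z) + g2 r / 2 * (sqrt h * z)\<^sup>2"
      using taylor_two[OF d1 d2] by blast
    have "\<bar>g2 r / 2\<bar> * (h * z\<^sup>2) \<le> M / 2 * (h * z\<^sup>2)"
      using M[of r] \<open>h \<ge> 0\<close> by (intro mult_right_mono) auto
    then show ?thesis
      using r \<open>h \<ge> 0\<close> by (simp add: abs_mult power_mult_distrib algebra_simps)
  qed
  from std_normal_quartic_estimate[OF integrable_heat[OF g] this]
  show ?thesis by (simp add: heat_def)
qed

text \<open>The generator of the Gaussian semigroup is half the second derivative, uniformly in
  \<open>x\<close>. The Taylor remainder is governed by the oscillation of \<open>g2\<close>: small
  for short displacements by uniform continuity, at most \<open>2 * M\<close> for long ones.\<close>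

lemma heat_second_order:
  assumes g: "g \<in> borel_measurable borel" "\<And>y. \<bar>g y\<bar> \<le> B"
    and d1: "\<And>y. (g has_real_derivative g1 y) (at y)"
    and d2: "\<And>y. (g1 has_real_derivative g2 y) (at y)"
    and M: "\<And>y. \<bar>g2 y\<bar> \<le> M" and unif: "uniformly_continuous_on UNIV g2" and "e > 0"
  shows "\<forall>\<^sub>F h in at_right 0. \<forall>x. \<bar>heat h g x - g x - h / 2 * g2 x\<bar> \<le> e * h"
proof -
  obtain d where "d > 0" and d: "\<And>x y. \<bar>y - x\<bar> < d \<Longrightarrow> \<bar>g2 y - g2 x\<bar> < e"
    using unif \<open>e > 0\<close> unfolding uniformly_continuous_on_def dist_real_def by (metis UNIV_I)
  have "M \<ge> 0" using M[of 0] by simp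
  \<comment> \<open>Chosen so that \<open>K * z\<^sup>2\<close> reaches the trivial bound
    \<open>2 * M\<close> once \<open>\<bar>z\<bar> \<ge> d\<close>; one quadratic bound then covers
    short and long displacements.\<close>
  define K where "K = 2 * M / d\<^sup>2"
  have "K \<ge> 0" using \<open>M \<ge> 0\<close> by (simp add: K_def)
  have modulus: "\<bar>g2 r - g2 x\<bar> \<le> e + K * z\<^sup>2" if "\<bar>r - x\<bar> \<le> \<bar>z\<bar>" for r x z
  proof (cases "\<bar>z\<bar> < d")
    case True
    have "\<bar>g2 r - g2 x\<bar> < e" using d that True by simp
    moreover have "K * z\<^sup>2 \<ge> 0" using \<open>K \<ge> 0\<close> by simp
    ultimately show ?thesis by linarith
  next
    case False
    have "\<bar>d\<bar> \<le> \<bar>z\<bar>" using False \<open>d > 0\<close> by simp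
    then have "d\<^sup>2 \<le> z\<^sup>2" using abs_le_square_iff by blast
    then have "1 \<le> z\<^sup>2 / d\<^sup>2" using \<open>d > 0\<close> by simp
    then have "2 * M * 1 \<le> 2 * M * (z\<^sup>2 / d\<^sup>2)" using \<open>M \<ge> 0\<close> by (intro mult_left_mono) auto
    then show ?thesis using M[of r] M[of x] \<open>e > 0\<close> by (simp add: K_def)
  qed
  \<comment> \<open>A displacement \<open>sqrt h * z\<close> makes the oscillation bound
    \<open>e + K * h * z\<^sup>2\<close>; multiplied by \<open>h / 2 * z\<^sup>2\<close> it yields a
    quadratic term of order \<open>h\<close> and a quartic one of order
    \<open>h\<^sup>2\<close>.\<close>
  have est: "\<bar>heat h g x - g x - h / 2 * g2 x\<bar> \<le> e / 2 * h + 3 * (K / 2 * h\<^sup>2)" if "h > 0" for h x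
  proof -
    have "\<bar>g (x + sqrt h * z) - (g x + (g1 x * sqrt h) * z + (h / 2 * g2 x) * z\<^sup>2)\<bar>
        \<le> (e / 2 * h) * z\<^sup>2 + (K / 2 * h\<^sup>2) * z ^ 4" for z
    proof -
      obtain r where r: "\<bar>r - x\<bar> \<le> \<bar>sqrt h * z\<bar>"
        "g (x + sqrt h * z) = g x + g1 x * (sqrt h * z) + g2 r / 2 * (sqrt h * z)\<^sup>2"
        using taylor_two[OF d1 d2] by blast
      have "\<bar>g2 r - g2 x\<bar> \<le> e + K * (h * z\<^sup>2)"
        using modulus[OF r(1)] \<open>h > 0\<close> by (simp add: power_mult_distrib)
      then have "\<bar>g2 r - g2 x\<bar> * (h / 2 * z\<^sup>2) \<le> (e + K * (h * z\<^sup>2)) * (h / 2 * z\<^sup>2)"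
        using \<open>h > 0\<close> by (intro mult_right_mono) auto
      also have "\<dots> = (e / 2 * h) * z\<^sup>2 + (K / 2 * h\<^sup>2) * z ^ 4"
        by (simp add: field_simps power2_eq_square power4_eq_xxxx)
      finally have "\<bar>(g2 r - g2 x) * (h / 2 * z\<^sup>2)\<bar> \<le> (e / 2 * h) * z\<^sup>2 + (K / 2 * h\<^sup>2) * z ^ 4"
        using \<open>h > 0\<close> by (simp add: abs_mult)
      moreover have "g (x + sqrt h * z) - (g x + (g1 x * sqrt h) * z + (h / 2 * g2 x) * z\<^sup>2)
          = (g2 r - g2 x) * (h / 2 * z\<^sup>2)"
        using r(2) \<open>h > 0\<close> by (simp add: power_mult_distrib field_simps)
      ultimately show ?thesis by simp
    qed
    from std_normal_quartic_estimate[OF integrable_heat[OF g] this]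
    show ?thesis by (simp add: heat_def algebra_simps)
  qed
  \<comment> \<open>Below this threshold \<open>3 * K * h < e\<close>, so the quartic part is at
    most \<open>e / 2 * h\<close>. The added 1 keeps the denominator positive when
    \<open>K = 0\<close>.\<close>
  have "0 < e / (3 * K + 1)" using \<open>e > 0\<close> \<open>K \<ge> 0\<close> by simp
  then have "\<forall>\<^sub>F h in at_right 0. h \<in> {0<..<e / (3 * K + 1)}"
    by (rule eventually_at_right_real)
  then show ?thesis
  proof eventually_elim
    case (elim h)
    then have "h * (3 * K + 1) < e" using \<open>K \<ge> 0\<close> by (simp add: field_simps)
    then have "3 * K * h < e" using elim by (simp add: algebra_simps)
    then have "3 * K * h * h \<le> e * h" using elim by (intro mult_right_mono) auto
    then have "e / 2 * h + 3 * (K / 2 * h\<^sup>2) \<le> e * h" by (simp add: power2_eq_square)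
    then show ?case
      using est[of h] elim by (intro allI) (rule order_trans, auto)
  qed
qed

lemma heat_measurable [measurable]:
  assumes [measurable]: "g \<in> borel_measurable borel"
  shows "heat t g \<in> borel_measurable borel"
  unfolding heat_def by measurable

lemma bcontfun_measurable [measurable]:
  fixes g :: "real \<Rightarrow>\<^sub>C real"
  shows "apply_bcontfun g \<in> borel_measurable borel"
  by (rule borel_measurable_continuous_onI) simp

lemma bcontfun_abs_le:
  fixes g :: "real \<Rightarrow>\<^sub>C real"
  shows "\<bar>apply_bcontfun g y\<bar> \<le> norm g"
  using norm_bounded[of g y] by simp

section \<open>Uniqueness for the heat equation\<close>

text \<open>A classical solution with these bounds is the Gaussian flow of its initial value. The
  curve \<open>\<phi>\<close> joins the two sides of the equation; to first order in
  \<open>r - s\<close>, both \<open>v r\<close> and the Gaussian flow of \<open>v s\<close> equal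
  \<open>v s + ((r - s) / 2) * w s\<close> in supremum norm, so the right derivative of
  \<open>\<phi>\<close> vanishes.\<close>

lemma heat_representation:
  fixes v w :: "real \<Rightarrow> (real \<Rightarrow>\<^sub>C real)"
  assumes "t \<ge> 0" and cont: "continuous_on {0..t} v"
    and deriv: "\<And>s. \<lbrakk>0 \<le> s; s < t\<rbrakk> \<Longrightarrow> (v has_vector_derivative (1/2) *\<^sub>R w s) (at_right s)"
    and M: "\<And>s. s \<in> {0..t} \<Longrightarrow> norm (w s) \<le> M"
    and d1: "\<And>s y. s \<in> {0..t} \<Longrightarrow> (apply_bcontfun (v s) has_real_derivative v' s y) (at y)"
    and d2: "\<And>s y. s \<in> {0..t} \<Longrightarrow> (v' s has_real_derivative apply_bcontfun (w s) y) (at y)"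
    and unif: "\<And>s. s \<in> {0..t} \<Longrightarrow> uniformly_continuous_on UNIV (apply_bcontfun (w s))"
  shows "apply_bcontfun (v t) x = heat t (apply_bcontfun (v 0)) x"
proof -
  define \<phi> where "\<phi> s = heat (t - s) (apply_bcontfun (v s)) x" for s
  have M': "\<bar>apply_bcontfun (w s) y\<bar> \<le> M" if "s \<in> {0..t}" for s y
    using bcontfun_abs_le[of "w s" y] M[OF that] by simp
  \<comment> \<open>The semigroup property writes both values of \<open>\<phi>\<close> with the same
    operator \<open>heat (t - r)\<close>, a contraction, so it suffices to compare functions at time
    \<open>r\<close>.\<close>
  have incr: "\<bar>\<phi> r - \<phi> s\<bar> \<le> K"
    if "0 \<le> s" "s \<le> r" "r \<le> t"
      and K: "\<And>y. \<bar>apply_bcontfun (v r) y - heat (r - s) (apply_bcontfun (v s)) y\<bar> \<le> K" for r s K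
  proof -
    have "\<phi> s = heat (t - r) (heat (r - s) (apply_bcontfun (v s))) x"
      unfolding \<phi>_def using that by (subst heat_heat[OF _ _ _ bcontfun_abs_le]) auto
    then have "\<phi> r - \<phi> s
        = heat (t - r) (\<lambda>y. apply_bcontfun (v r) y - heat (r - s) (apply_bcontfun (v s)) y) x"
      unfolding \<phi>_def
      by (subst heat_diff[OF _ bcontfun_abs_le _ abs_heat_le[OF _ bcontfun_abs_le]]) auto
    then show ?thesis
      by (simp add: abs_heat_le K)
  qed
  have step: "\<bar>\<phi> r - \<phi> s\<bar> \<le> dist (v r) (v s) + M / 2 * (r - s)" if "0 \<le> s" "s \<le> r" "r \<le> t" for r s
  proof (rule incr[OF that])
    fix y
    have "\<bar>heat (r - s) (apply_bcontfun (v s)) y - apply_bcontfun (v s) y\<bar> \<le> M / 2 * (r - s)"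
      using that by (intro heat_estimate[OF _ bcontfun_abs_le d1 d2 M']) auto
    moreover have "\<bar>apply_bcontfun (v r) y - apply_bcontfun (v s) y\<bar> \<le> dist (v r) (v s)"
      using dist_bounded[of "v r" y "v s"] by (simp add: dist_real_def)
    ultimately show "\<bar>apply_bcontfun (v r) y - heat (r - s) (apply_bcontfun (v s)) y\<bar>
        \<le> dist (v r) (v s) + M / 2 * (r - s)"
      by linarith
  qed
  have "continuous_on {0..t} \<phi>"
    unfolding continuous_on_def
  proof
    fix s assume s: "s \<in> {0..t}"
    have "((\<lambda>r. dist (v r) (v s) + M / 2 * \<bar>r - s\<bar>) \<longlongrightarrow> dist (v s) (v s) + M / 2 * \<bar>s - s\<bar>) (at s within {0..t})"
      using cont s by (intro tendsto_intros) (auto simp: continuous_on_def)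
    then have lim: "((\<lambda>r. dist (v r) (v s) + M / 2 * \<bar>r - s\<bar>) \<longlongrightarrow> 0) (at s within {0..t})"
      by simp
    show "(\<phi> \<longlongrightarrow> \<phi> s) (at s within {0..t})"
    proof (rule LIM_zero_cancel, rule Lim_null_comparison[OF _ lim])
      show "\<forall>\<^sub>F r in at s within {0..t}. norm (\<phi> r - \<phi> s) \<le> dist (v r) (v s) + M / 2 * \<bar>r - s\<bar>"
        unfolding eventually_at_filter
      proof (intro always_eventually allI impI)
        fix r assume "r \<in> {0..t}"
        then show "norm (\<phi> r - \<phi> s) \<le> dist (v r) (v s) + M / 2 * \<bar>r - s\<bar>"
          using s step[of s r] step[of r s]
          by (cases "s \<le> r") (auto simp: dist_commute abs_minus_commute)
      qed
    qed
  qed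
  moreover have "\<forall>\<^sub>F r in at_right s. norm (\<phi> r - \<phi> s) \<le> e * (r - s)" if "0 \<le> s" "s < t" "e > 0" for s e
  proof -
    have s: "s \<in> {0..t}" using that by auto
    \<comment> \<open>The error \<open>e\<close> is split equally between the expansion of
      \<open>v\<close> in time and that of the Gaussian flow.\<close>
    have e2: "e / 2 > 0" using \<open>e > 0\<close> by simp
    have "\<forall>\<^sub>F r in at_right s. norm (v r - v s - (r - s) *\<^sub>R (1/2) *\<^sub>R w s) \<le> e / 2 * norm (r - s)"
      using deriv[OF that(1,2)] e2
      unfolding has_vector_derivative_def has_derivative_within_alt2 by blast
    moreover have "\<forall>\<^sub>F r in at_right s. \<forall>y. \<bar>heat (r - s) (apply_bcontfun (v s)) y - apply_bcontfun (v s) y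
        - (r - s) / 2 * apply_bcontfun (w s) y\<bar> \<le> e / 2 * (r - s)"
      unfolding eventually_at_right_to_0[of _ s]
      using heat_second_order[OF _ bcontfun_abs_le d1[OF s] d2[OF s] M'[OF s] unif[OF s] e2]
      by simp
    moreover have "\<forall>\<^sub>F r in at_right s. r \<in> {s<..<t}"
      using \<open>s < t\<close> by (rule eventually_at_right_real)
    ultimately show ?thesis
    proof eventually_elim
      case (elim r)
      have "\<bar>\<phi> r - \<phi> s\<bar> \<le> e * (r - s)"
      proof (rule incr)
        fix y
        have "\<bar>apply_bcontfun (v r) y - apply_bcontfun (v s) y - (r - s) / 2 * apply_bcontfun (w s) y\<bar>
            \<le> norm (v r - v s - (r - s) *\<^sub>R (1/2) *\<^sub>R w s)"
          using bcontfun_abs_le[of "v r - v s - (r - s) *\<^sub>R (1/2) *\<^sub>R w s" y] by simp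
        also have "\<dots> \<le> e / 2 * (r - s)" using elim by simp
        finally show "\<bar>apply_bcontfun (v r) y - heat (r - s) (apply_bcontfun (v s)) y\<bar> \<le> e * (r - s)"
          using elim(2)[rule_format, of y] by (simp add: field_simps abs_le_iff)
      qed (use elim that in auto)
      then show ?case by simp
    qed
  qed
  ultimately have "\<phi> t = \<phi> 0"
    by (rule constant_if_right_derivative_zero[OF \<open>t \<ge> 0\<close>])
  then show ?thesis by (simp add: \<phi>_def)
qed

lemma uniformly_continuous_on_UNIV_if_limits:
  fixes g :: "real \<Rightarrow> 'a::metric_space"
  assumes cont: "continuous_on UNIV g" and top: "(g \<longlongrightarrow> a) at_top" and bot: "(g \<longlongrightarrow> b) at_bot"
  shows "uniformly_continuous_on UNIV g"
  unfolding uniformly_continuous_on_def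
proof (intro allI impI)
  fix e :: real assume "e > 0"
  then have e2: "e / 2 > 0" by simp
  obtain K where K: "\<And>x. x \<ge> K \<Longrightarrow> dist (g x) a < e / 2"
    using tendstoD[OF top e2] unfolding eventually_at_top_linorder by blast
  obtain k where k: "\<And>x. x \<le> k \<Longrightarrow> dist (g x) b < e / 2"
    using tendstoD[OF bot e2] unfolding eventually_at_bot_linorder by blast
  \<comment> \<open>The middle interval is enlarged by 1 at each end, so that two points less than 1
    apart lie together in it or together in one tail.\<close>
  have "uniformly_continuous_on {k - 1..K + 1} g"
    by (rule compact_uniformly_continuous[OF continuous_on_subset[OF cont]]) auto
  then obtain d where "d > 0" and d: "\<And>x y. \<lbrakk>x \<in> {k - 1..K + 1}; y \<in> {k - 1..K + 1}; dist y x < d\<rbrakk>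
      \<Longrightarrow> dist (g y) (g x) < e"
    using \<open>e > 0\<close> unfolding uniformly_continuous_on_def by blast
  show "\<exists>d>0. \<forall>x\<in>UNIV. \<forall>y\<in>UNIV. dist y x < d \<longrightarrow> dist (g y) (g x) < e"
  proof (intro exI[of _ "min d 1"] conjI ballI impI)
    fix x y :: real assume xy: "dist y x < min d 1"
    then have "\<bar>y - x\<bar> < 1" by (simp add: dist_real_def)
    then consider "x \<in> {k - 1..K + 1}" "y \<in> {k - 1..K + 1}" | "x \<ge> K" "y \<ge> K" | "x \<le> k" "y \<le> k"
      by (smt (verit) atLeastAtMost_iff)
    then show "dist (g y) (g x) < e"
    proof cases
      case 1
      then show ?thesis using d xy by simp
    next
      case 2
      then show ?thesis using K[of x] K[of y] dist_triangle_half_r[of a "g y" e "g x"]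
        by (simp add: dist_commute)
    next
      case 3
      then show ?thesis using k[of x] k[of y] dist_triangle_half_r[of b "g y" e "g x"]
        by (simp add: dist_commute)
    qed
  qed (use \<open>d > 0\<close> in auto)
qed

section \<open>Orbits of a strongly continuous semigroup\<close>

text \<open>Translates between derivatives of orbits and the difference quotients at 0 by which
  \<open>generator\<close> is defined.\<close>

lemma has_vector_derivative_at_right_iff:
  "(f has_vector_derivative D) (at_right s) \<longleftrightarrow> ((\<lambda>h. (f (h + s) - f s) /\<^sub>R h) \<longlongrightarrow> D) (at_right 0)"
proof -
  have "\<forall>\<^sub>F h in at_right 0. norm (f (h + s) - f s - h *\<^sub>R D) / norm h
      = norm ((f (h + s) - f s) /\<^sub>R h - D)"
    using eventually_at_right_less[of "0::real"]
  proof eventually_elim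
    case (elim h)
    then have "(f (h + s) - f s) /\<^sub>R h - D = (f (h + s) - f s - h *\<^sub>R D) /\<^sub>R h"
      by (simp add: scaleR_diff_right)
    then show ?case by (simp add: divide_inverse mult.commute)
  qed
  then have "((\<lambda>h. norm (f (h + s) - f s - h *\<^sub>R D) / norm h) \<longlongrightarrow> 0) (at_right 0)
      \<longleftrightarrow> ((\<lambda>h. norm ((f (h + s) - f s) /\<^sub>R h - D)) \<longlongrightarrow> 0) (at_right 0)"
    by (rule tendsto_cong)
  then show ?thesis
    unfolding has_vector_derivative_def has_derivative_iff_norm filterlim_at_right_to_0[of _ _ s]
    by (simp add: bounded_linear_scaleR_left LIM_zero_iff tendsto_norm_zero_iff)
qed

context
  fixes T :: "real \<Rightarrow> 'a::banach \<Rightarrow>\<^sub>L 'a"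
  assumes T: "strongly_continuous_semigroup T"
begin

lemma semigroup_zero: "T 0 f = f"
  using T unfolding strongly_continuous_semigroup_def by simp

lemma semigroup_add: "s \<ge> 0 \<Longrightarrow> t \<ge> 0 \<Longrightarrow> T (s + t) f = T s (T t f)"
  using T unfolding strongly_continuous_semigroup_def by simp

lemma semigroup_continuous: "continuous_on {0..} (\<lambda>t. T t f)"
  using T unfolding strongly_continuous_semigroup_def by simp

text \<open>\<open>T s\<close> commutes with \<open>T h\<close> and, being bounded and linear,
  passes through the limit of difference quotients.\<close>

lemma generator_orbit:
  assumes "(f, g) \<in> generator T" "s \<ge> 0"
  shows "(T s f, T s g) \<in> generator T"
proof -
  have "((\<lambda>h. T s ((T h f - f) /\<^sub>R h)) \<longlongrightarrow> T s g) (at_right 0)"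
    using assms(1) by (intro blinfun.tendsto tendsto_const) (simp add: generator_def)
  moreover have "\<forall>\<^sub>F h in at_right 0. T s ((T h f - f) /\<^sub>R h) = (T h (T s f) - T s f) /\<^sub>R h"
    using eventually_at_right_less[of "0::real"]
  proof eventually_elim
    case (elim h)
    then have "T s (T h f) = T h (T s f)"
      using semigroup_add[of s h f] semigroup_add[of h s f] \<open>s \<ge> 0\<close> by (simp add: add.commute)
    then show ?case by (simp add: blinfun.scaleR_right blinfun.diff_right)
  qed
  ultimately show ?thesis
    unfolding generator_def by (auto elim: Lim_transform_eventually)
qed

lemma semigroup_right_derivative:
  assumes "(f, g) \<in> generator T" "s \<ge> 0"
  shows "((\<lambda>t. T t f) has_vector_derivative T s g) (at_right s)"
proof -
  have "((\<lambda>h. (T h (T s f) - T s f) /\<^sub>R h) \<longlongrightarrow> T s g) (at_right 0)"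
    using generator_orbit[OF assms] by (simp add: generator_def)
  moreover have "\<forall>\<^sub>F h in at_right 0. (T h (T s f) - T s f) /\<^sub>R h = (T (h + s) f - T s f) /\<^sub>R h"
    using eventually_at_right_less[of "0::real"]
    by eventually_elim (simp add: semigroup_add \<open>s \<ge> 0\<close>)
  ultimately show ?thesis
    unfolding has_vector_derivative_at_right_iff by (rule Lim_transform_eventually)
qed

text \<open>The averages of the orbit over \<open>{0..h}\<close> converge to \<open>f\<close>, and
  each is in the domain: applying \<open>T r\<close> shifts the window of integration, so only its
  two ends contribute to the difference quotient.\<close>

lemma generator_domain_dense: "f \<in> closure (Domain (generator T))"
proof -
  define F where "F h = integral {0..h} (\<lambda>s. T s f)" for h
  have cont: "continuous_on {a..b} (\<lambda>s. T s f)" if "a \<ge> 0" for a b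
    using that by (intro continuous_on_subset[OF semigroup_continuous]) auto
  have F: "(F has_vector_derivative T h f) (at_right h)" if "h \<ge> 0" for h
  proof -
    have "(F has_vector_derivative T h f) (at h within {0..h + 1})"
      unfolding F_def using that by (intro integral_has_vector_derivative cont) auto
    then have "(F has_vector_derivative T h f) (at h within {h..h + 1})"
      by (rule has_vector_derivative_within_subset) (use that in auto)
    then show ?thesis
      using at_within_Icc_at_right[of h "h + 1"] by simp
  qed
  have quotient: "((\<lambda>r. (F (r + h) - F h) /\<^sub>R r) \<longlongrightarrow> T h f) (at_right 0)" if "h \<ge> 0" for h
    using F[OF that] unfolding has_vector_derivative_at_right_iff .
  have "((\<lambda>h. F h /\<^sub>R h) \<longlongrightarrow> f) (at_right 0)"
    using quotient[of 0] by (simp add: F_def semigroup_zero)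
  moreover have "F h /\<^sub>R h \<in> Domain (generator T)" if "h > 0" for h
  proof -
    have shift: "T r (F h) = F (r + h) - F r" if "r \<ge> 0" for r
    proof -
      have "T r (F h) = integral {0..h} (\<lambda>s. T r (T s f))"
        unfolding F_def
        using integral_linear[OF integrable_continuous_real[OF cont] blinfun.bounded_linear_right, of 0 h "T r"]
        by (simp add: o_def)
      also have "\<dots> = integral {0..h} ((\<lambda>s. T s f) \<circ> (+) r)"
        using that by (intro integral_cong) (simp add: semigroup_add)
      also have "\<dots> = integral {r..r + h} (\<lambda>s. T s f)"
        by (subst integral_shift_Icc_real) (simp add: add.commute)
      also have "\<dots> = F (r + h) - F r"
        using Henstock_Kurzweil_Integration.integral_combine[of 0 r "r + h" "\<lambda>s. T s f"]
          that \<open>h > 0\<close> integrable_continuous_real[OF cont[of 0]]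
        by (simp add: F_def algebra_simps)
      finally show ?thesis .
    qed
    \<comment> \<open>The upper end of the window contributes the right derivative of
      \<open>F\<close> at \<open>h\<close>, the lower end the one at 0.\<close>
    have "((\<lambda>r. ((F (r + h) - F h) /\<^sub>R r - (F (r + 0) - F 0) /\<^sub>R r) /\<^sub>R h) \<longlongrightarrow> (T h f - T 0 f) /\<^sub>R h) (at_right 0)"
      using \<open>h > 0\<close> by (intro tendsto_intros quotient) auto
    moreover have "\<forall>\<^sub>F r in at_right 0. ((F (r + h) - F h) /\<^sub>R r - (F (r + 0) - F 0) /\<^sub>R r) /\<^sub>R h
        = (T r (F h /\<^sub>R h) - F h /\<^sub>R h) /\<^sub>R r"
      using eventually_at_right_less[of "0::real"]
    proof eventually_elim
      case (elim r)
      then have "(F (r + h) - F h) - (F (r + 0) - F 0) = T r (F h) - F h"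
        using shift[of r] by (simp add: F_def)
      then show ?case
        by (simp add: blinfun.scaleR_right mult.commute flip: scaleR_diff_right)
    qed
    ultimately have "(F h /\<^sub>R h, (T h f - T 0 f) /\<^sub>R h) \<in> generator T"
      unfolding generator_def by (auto elim: Lim_transform_eventually)
    then show ?thesis by blast
  qed
  then have "\<forall>\<^sub>F h in at_right 0. F h /\<^sub>R h \<in> closure (Domain (generator T))"
    using eventually_at_right_less[of "0::real"] closure_subset by (auto elim!: eventually_mono)
  ultimately show ?thesis
    by (intro Lim_in_closed_set[OF closed_closure]) auto
qed

end

section \<open>Extension across the transmission point\<close>

text \<open>\<open>r\<close> and \<open>l\<close> are the one-sided first derivatives. One function
  \<open>G\<close> serves both sides, which encodes the matching of second derivatives at 0. Plain
  functions instead of \<open>cext\<close> allow reflection and rescaling.\<close>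

definition transmission_C2 :: "real \<Rightarrow> real \<Rightarrow> (real \<Rightarrow> real) \<Rightarrow> (real \<Rightarrow> real) \<Rightarrow> bool" where
  "transmission_C2 p q F G \<longleftrightarrow> (\<exists>r l.
     (\<forall>y\<ge>0. (F has_real_derivative r y) (at y within {0..}) \<and> (r has_real_derivative G y) (at y within {0..})) \<and>
     (\<forall>y\<le>0. (F has_real_derivative l y) (at y within {..0}) \<and> (l has_real_derivative G y) (at y within {..0})) \<and>
     p * r 0 = q * l 0)"

lemma deriv_on_works:
  "f differentiable_on S \<Longrightarrow> x \<in> S \<Longrightarrow> (f has_real_derivative deriv_on S f x) (at x within S)"
  unfolding deriv_on_def differentiable_on_def has_real_derivative_iff_has_vector_derivative
  by (simp add: vector_derivative_works)

lemma delta_star_transmission_C2: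
  assumes "(f, g) \<in> delta_star p q"
  shows "transmission_C2 p q (cext_apply f) (cext_apply g)"
  unfolding transmission_C2_def
proof (intro exI conjI allI impI)
  have r: "C2_on {0..} (cext_apply f)" and l: "C2_on {..0} (cext_apply f)"
    and gr: "\<And>x. x \<ge> 0 \<Longrightarrow> cext_apply g x = deriv_on {0..} (deriv_on {0..} (cext_apply f)) x"
    and gl: "\<And>x. x \<le> 0 \<Longrightarrow> cext_apply g x = deriv_on {..0} (deriv_on {..0} (cext_apply f)) x"
    using assms by (auto simp: delta_star_def delta_star_domain_def)
  fix y :: real
  show "(cext_apply f has_real_derivative deriv_on {0..} (cext_apply f) y) (at y within {0..})"
    "(deriv_on {0..} (cext_apply f) has_real_derivative cext_apply g y) (at y within {0..})" if "y \<ge> 0"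
    using that r unfolding gr[OF that] C2_on_def by (auto intro: deriv_on_works)
  show "(cext_apply f has_real_derivative deriv_on {..0} (cext_apply f) y) (at y within {..0})"
    "(deriv_on {..0} (cext_apply f) has_real_derivative cext_apply g y) (at y within {..0})" if "y \<le> 0"
    using that l unfolding gl[OF that] C2_on_def by (auto intro: deriv_on_works)
  show "p * deriv_on {0..} (cext_apply f) 0 = q * deriv_on {..0} (cext_apply f) 0"
    using assms by (auto simp: delta_star_def delta_star_domain_def)
qed

lemma DERIV_mirror_within:
  assumes "(f has_real_derivative D) (at (- y) within S)"
  shows "((\<lambda>y. f (- y)) has_real_derivative - D) (at y within uminus ` S)"
proof -
  have "(f \<circ> uminus has_real_derivative D * - 1) (at y within uminus ` S)"
    by (rule DERIV_image_chain)
       (use assms in \<open>auto simp: image_image intro!: derivative_eq_intros\<close>)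
  then show ?thesis by (simp add: o_def)
qed

text \<open>Reflection swaps the half-lines and changes the sign of first derivatives but not of
  second ones; the weights in the condition at 0 trade places. The case \<open>x < 0\<close> thereby
  reduces to \<open>x > 0\<close>.\<close>

lemma transmission_C2_mirror:
  assumes "transmission_C2 p q F G"
  shows "transmission_C2 q p (\<lambda>y. F (- y)) (\<lambda>y. G (- y))"
proof -
  obtain r l where
    r: "\<And>y. y \<ge> 0 \<Longrightarrow> (F has_real_derivative r y) (at y within {0..})"
       "\<And>y. y \<ge> 0 \<Longrightarrow> (r has_real_derivative G y) (at y within {0..})" and
    l: "\<And>y. y \<le> 0 \<Longrightarrow> (F has_real_derivative l y) (at y within {..0})"
       "\<And>y. y \<le> 0 \<Longrightarrow> (l has_real_derivative G y) (at y within {..0})" and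
    eq: "p * r 0 = q * l 0"
    using assms unfolding transmission_C2_def by blast
  show ?thesis
    unfolding transmission_C2_def
  proof (rule exI[of _ "\<lambda>y. - l (- y)"], rule exI[of _ "\<lambda>y. - r (- y)"], intro conjI allI impI)
    fix y :: real
    show "((\<lambda>y. F (- y)) has_real_derivative - l (- y)) (at y within {0..})"
      "((\<lambda>y. - l (- y)) has_real_derivative G (- y)) (at y within {0..})" if "y \<ge> 0"
      using DERIV_mirror_within[OF l(1), of y] DERIV_minus[OF DERIV_mirror_within[OF l(2), of y]] that
      by simp_all
    show "((\<lambda>y. F (- y)) has_real_derivative - r (- y)) (at y within {..0})"
      "((\<lambda>y. - r (- y)) has_real_derivative G (- y)) (at y within {..0})" if "y \<le> 0"
      using DERIV_mirror_within[OF r(1), of y] DERIV_minus[OF DERIV_mirror_within[OF r(2), of y]] that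
      by simp_all
  qed (use eq in simp)
qed

lemma DERIV_glue_at_zero:
  fixes f g :: "real \<Rightarrow> real"
  assumes f: "\<And>y. y \<ge> 0 \<Longrightarrow> (f has_real_derivative f' y) (at y within {0..})"
    and g: "\<And>y. y \<le> 0 \<Longrightarrow> (g has_real_derivative g' y) (at y within {..0})"
    and "f 0 = g 0" "f' 0 = g' 0"
  shows "((\<lambda>y. if y \<ge> 0 then f y else g y) has_real_derivative (if y \<ge> 0 then f' y else g' y)) (at y)"
proof -
  \<comment> \<open>The branches live on \<open>{0..}\<close> and \<open>{..<0}\<close>; the
    closures meet only at 0, so values and derivatives have to agree there alone.\<close>
  have "closure {0::real..} \<inter> closure {..<0} = {0}" by auto
  moreover have "insert 0 {0::real..} = {0..}" "insert 0 {..<0::real} = {..0}" "{..<0} \<union> {0::real..} = UNIV" by auto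
  ultimately show ?thesis
    using has_vector_derivative_If_within_closures[of y "{0..}" "{..<0}" UNIV f f' g g'] assms
    unfolding has_real_derivative_iff_has_vector_derivative
    by (auto simp: Un_commute)
qed

text \<open>The two coefficients on the left sum to 1, so the branches agree at 0 for every
  continuous \<open>F\<close> and every \<open>a\<close>.\<close>

definition reflect_extend :: "real \<Rightarrow> (real \<Rightarrow> real) \<Rightarrow> real \<Rightarrow> real" where
  "reflect_extend a F y = (if y \<ge> 0 then F y else a * F (- y) + (1 - a) * F y)"

text \<open>The left branch has slope \<open>- a * r 0 + (1 - a) * l 0\<close> at 0. This equals
  \<open>r 0\<close> when \<open>(1 + a) * r 0 = (1 - a) * l 0\<close>, which is the transmission
  condition multiplied by \<open>2 / (p + q)\<close>. A second differentiation restores the sign of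
  the reflected term, so the second derivative is again an extension of the same form.\<close>

lemma reflect_extend_C2:
  assumes "transmission_C2 p q F G" and "p + q > 0" and a: "a = (p - q) / (p + q)"
  obtains E where "\<And>y. (reflect_extend a F has_real_derivative E y) (at y)"
    "\<And>y. (E has_real_derivative reflect_extend a G y) (at y)"
proof -
  obtain r l where
    r: "\<And>y. y \<ge> 0 \<Longrightarrow> (F has_real_derivative r y) (at y within {0..})"
       "\<And>y. y \<ge> 0 \<Longrightarrow> (r has_real_derivative G y) (at y within {0..})" and
    l: "\<And>y. y \<le> 0 \<Longrightarrow> (F has_real_derivative l y) (at y within {..0})"
       "\<And>y. y \<le> 0 \<Longrightarrow> (l has_real_derivative G y) (at y within {..0})" and
    eq: "p * r 0 = q * l 0"
    using assms unfolding transmission_C2_def by blast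
  define E where "E y = (if y \<ge> 0 then r y else - a * r (- y) + (1 - a) * l y)" for y
  have m: "((\<lambda>y. F (- y)) has_real_derivative - r (- y)) (at y within {..0})"
    "((\<lambda>y. r (- y)) has_real_derivative - G (- y)) (at y within {..0})" if "y \<le> 0" for y
    using DERIV_mirror_within[OF r(1), of y] DERIV_mirror_within[OF r(2), of y] that by simp_all
  show ?thesis
  proof (rule that)
    have "1 + a = 2 * p / (p + q)" "1 - a = 2 * q / (p + q)"
      using \<open>p + q > 0\<close> by (simp_all add: a field_simps)
    then have "(1 + a) * r 0 = (1 - a) * l 0"
      using eq by simp
    then have "r 0 = - a * r 0 + (1 - a) * l 0"
      by (simp add: algebra_simps)
    then show "(reflect_extend a F has_real_derivative E y) (at y)" for y
      unfolding reflect_extend_def[abs_def] E_def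
      by (intro DERIV_glue_at_zero) (auto intro!: derivative_eq_intros r l m simp: algebra_simps)
    then show "(E has_real_derivative reflect_extend a G y) (at y)" for y
      unfolding reflect_extend_def E_def[abs_def] using \<open>r 0 = - a * r 0 + (1 - a) * l 0\<close>
      by (intro DERIV_glue_at_zero) (auto intro!: derivative_eq_intros r l m simp: algebra_simps)
  qed
qed

section \<open>The extension as a bounded operator\<close>

lemma cext_apply_abs_le: "\<bar>cext_apply f x\<bar> \<le> norm f"
  unfolding cext_apply_def norm_cext.rep_eq by (rule bcontfun_abs_le)

lemma cext_apply_measurable [measurable]: "cext_apply f \<in> borel_measurable borel"
  unfolding cext_apply_def by measurable

text \<open>The sign \<open>\<sigma> = \<plusminus>1\<close> selects the half-line whose values are extended.\<close>

definition extend :: "real \<Rightarrow> real \<Rightarrow> cext \<Rightarrow> (real \<Rightarrow>\<^sub>C real)" where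
  "extend a \<sigma> f = Bcontfun (reflect_extend a (\<lambda>y. cext_apply f (\<sigma> * y)))"

lemma reflect_extend_abs_le:
  assumes "\<And>y. \<bar>F y\<bar> \<le> B"
  shows "\<bar>reflect_extend a F y\<bar> \<le> (1 + \<bar>a\<bar> + \<bar>1 - a\<bar>) * B"
proof -
  have "B \<ge> 0" using assms[of 0] by simp
  then have "\<bar>a\<bar> * B \<ge> 0" "\<bar>1 - a\<bar> * B \<ge> 0" by auto
  moreover have "\<bar>a * F (- y)\<bar> \<le> \<bar>a\<bar> * B" "\<bar>(1 - a) * F y\<bar> \<le> \<bar>1 - a\<bar> * B"
    unfolding abs_mult using assms by (auto intro: mult_left_mono)
  ultimately show ?thesis
    using assms[of y] \<open>B \<ge> 0\<close> unfolding reflect_extend_def by (auto simp: algebra_simps)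
qed

lemma continuous_reflect_extend:
  assumes "continuous_on UNIV F"
  shows "continuous_on UNIV (reflect_extend a F)"
proof -
  have "continuous_on ({0..} \<union> {..0}) (\<lambda>y. if y \<ge> 0 then F y else a * F (- y) + (1 - a) * F y)"
    by (rule continuous_on_cases)
       (auto intro!: continuous_intros continuous_on_compose2[OF assms] simp: algebra_simps)
  moreover have "{0..} \<union> {..0} = (UNIV :: real set)" by auto
  ultimately show ?thesis unfolding reflect_extend_def[abs_def] by simp
qed

lemma extend_apply: "apply_bcontfun (extend a \<sigma> f) = reflect_extend a (\<lambda>y. cext_apply f (\<sigma> * y))"
proof -
  have "continuous_on UNIV (\<lambda>y. cext_apply f (\<sigma> * y))"
    by (intro continuous_on_compose2[OF cext_apply_continuous[of UNIV]] continuous_intros) auto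
  then have "reflect_extend a (\<lambda>y. cext_apply f (\<sigma> * y)) \<in> bcontfun"
    using reflect_extend_abs_le[of "\<lambda>y. cext_apply f (\<sigma> * y)" "norm f" a] cext_apply_abs_le
    by (intro bcontfun_normI continuous_reflect_extend) auto
  then show ?thesis unfolding extend_def by (rule Bcontfun_inverse)
qed

text \<open>This carries continuity and right derivatives of orbits in \<open>cext\<close> over to
  the extended functions in supremum norm.\<close>

lemma bounded_linear_extend: "bounded_linear (extend a \<sigma>)"
proof (rule bounded_linear_intro)
  fix f g :: cext and c :: real
  show "extend a \<sigma> (f + g) = extend a \<sigma> f + extend a \<sigma> g"
    by (rule bcontfun_eqI) (simp add: extend_apply reflect_extend_def algebra_simps)
  show "extend a \<sigma> (c *\<^sub>R f) = c *\<^sub>R extend a \<sigma> f"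
    by (rule bcontfun_eqI) (simp add: extend_apply reflect_extend_def algebra_simps)
  show "norm (extend a \<sigma> f) \<le> norm f * (1 + \<bar>a\<bar> + \<bar>1 - a\<bar>)"
    using reflect_extend_abs_le[of "\<lambda>y. cext_apply f (\<sigma> * y)" "norm f" a] cext_apply_abs_le
    by (intro norm_bound) (simp add: extend_apply mult.commute)
qed

text \<open>The extension inherits limits at both infinities from \<open>f\<close>; at minus
  infinity they mix with the weights \<open>a\<close> and \<open>1 - a\<close>.\<close>

lemma uniformly_continuous_extend:
  assumes \<sigma>: "\<sigma> = 1 \<or> \<sigma> = -1"
  shows "uniformly_continuous_on UNIV (apply_bcontfun (extend a \<sigma> f))"
proof -
  define F where "F = (\<lambda>y. cext_apply f (\<sigma> * y))"
  have cont: "continuous_on UNIV F"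
    unfolding F_def
    by (intro continuous_on_compose2[OF cext_apply_continuous[of UNIV]] continuous_intros) auto
  obtain b c where bc: "(cext_apply f \<longlongrightarrow> b) at_top" "(cext_apply f \<longlongrightarrow> c) at_bot"
    using cext_apply_limits by blast
  have "\<exists>b c. (F \<longlongrightarrow> b) at_top \<and> (F \<longlongrightarrow> c) at_bot"
    using \<sigma>
  proof
    assume "\<sigma> = -1"
    then show ?thesis
      using filterlim_compose[OF bc(1) filterlim_uminus_at_top_at_bot]
        filterlim_compose[OF bc(2) filterlim_uminus_at_bot_at_top] unfolding F_def by auto
  qed (use bc in \<open>auto simp: F_def\<close>)
  then obtain b c where top: "(F \<longlongrightarrow> b) at_top" and bot: "(F \<longlongrightarrow> c) at_bot" by blast
  have "(reflect_extend a F \<longlongrightarrow> b) at_top"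
  proof (rule Lim_transform_eventually[OF top])
    show "\<forall>\<^sub>F y in at_top. F y = reflect_extend a F y"
      using eventually_ge_at_top[of 0] by eventually_elim (simp add: reflect_extend_def)
  qed
  moreover have "(reflect_extend a F \<longlongrightarrow> a * b + (1 - a) * c) at_bot"
  proof (rule Lim_transform_eventually)
    show "((\<lambda>y. a * F (- y) + (1 - a) * F y) \<longlongrightarrow> a * b + (1 - a) * c) at_bot"
      by (intro tendsto_intros bot filterlim_compose[OF top filterlim_uminus_at_top_at_bot])
    show "\<forall>\<^sub>F y in at_bot. a * F (- y) + (1 - a) * F y = reflect_extend a F y"
      using eventually_gt_at_bot[of 0] by eventually_elim (simp add: reflect_extend_def)
  qed
  ultimately show ?thesis
    unfolding extend_apply F_def[symmetric]
    by (rule uniformly_continuous_on_UNIV_if_limits[OF continuous_reflect_extend[OF cont]])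
qed

section \<open>The semigroup on a half-line\<close>

text \<open>On the domain the extended orbit satisfies the hypotheses of
  \<open>heat_representation\<close>; in general both sides depend continuously on \<open>f\<close>
  in norm and the domain is dense. The factor 2 in \<open>gen\<close> undoes the scaling of the
  generator by 1/2.\<close>

lemma semigroup_eq_heat:
  fixes T :: "real \<Rightarrow> cext \<Rightarrow>\<^sub>L cext"
  assumes T: "strongly_continuous_semigroup T"
    and gen: "\<And>f g. (f, g) \<in> generator T \<Longrightarrow>
      transmission_C2 p q (\<lambda>y. cext_apply f (\<sigma> * y)) (\<lambda>y. 2 * cext_apply g (\<sigma> * y))"
    and "p + q > 0" and a: "a = (p - q) / (p + q)" and \<sigma>: "\<sigma> = 1 \<or> \<sigma> = -1" and "t \<ge> 0" "x \<ge> 0"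
  shows "cext_apply (T t f) (\<sigma> * x) = heat t (reflect_extend a (\<lambda>y. cext_apply f (\<sigma> * y))) x"
proof -
  interpret ext: bounded_linear "extend a \<sigma>" by (rule bounded_linear_extend)
  have dom: "cext_apply (T t f) (\<sigma> * x) = heat t (apply_bcontfun (extend a \<sigma> f)) x"
    if fg: "(f, g) \<in> generator T" for f g
  proof -
    define v where "v s = extend a \<sigma> (T s f)" for s
    \<comment> \<open>Along the orbit, twice the generator is the second space derivative; so
      \<open>w s\<close> is that of \<open>v s\<close>, and half of it is the time derivative of
      \<open>v\<close>.\<close>
    define w where "w s = extend a \<sigma> (2 *\<^sub>R T s g)" for s
    have "\<exists>E. \<forall>s\<ge>0. \<forall>y. (apply_bcontfun (v s) has_real_derivative E s y) (at y) \<and>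
        (E s has_real_derivative apply_bcontfun (w s) y) (at y)"
    proof (rule choice, rule allI)
      fix s
      show "\<exists>E. s \<ge> 0 \<longrightarrow> (\<forall>y. (apply_bcontfun (v s) has_real_derivative E y) (at y) \<and>
        (E has_real_derivative apply_bcontfun (w s) y) (at y))"
      proof (cases "s \<ge> 0")
        case True
        show ?thesis
        proof (rule reflect_extend_C2[OF gen[OF generator_orbit[OF T fg True]] \<open>p + q > 0\<close> a])
          fix E
          assume "\<And>y. (reflect_extend a (\<lambda>y. cext_apply (T s f) (\<sigma> * y)) has_real_derivative E y) (at y)"
            "\<And>y. (E has_real_derivative reflect_extend a (\<lambda>y. 2 * cext_apply (T s g) (\<sigma> * y)) y) (at y)"
          then show ?thesis
            by (intro exI[of _ E]) (simp add: v_def w_def extend_apply)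
        qed
      qed simp
    qed
    then obtain E where E: "\<And>s y. s \<ge> 0 \<Longrightarrow> (apply_bcontfun (v s) has_real_derivative E s y) (at y)"
      "\<And>s y. s \<ge> 0 \<Longrightarrow> (E s has_real_derivative apply_bcontfun (w s) y) (at y)"
      by blast
    have cont: "continuous_on {0..t} (\<lambda>s. T s h)" for h
      by (rule continuous_on_subset[OF semigroup_continuous[OF T]]) auto
    have cv: "continuous_on {0..t} v" and cw: "continuous_on {0..t} w"
      unfolding v_def w_def by (intro ext.continuous_on continuous_intros cont)+
    \<comment> \<open>The orbit of \<open>g\<close> over the compact interval \<open>{0..t}\<close>
      is bounded, which bounds the second derivatives uniformly in time.\<close>
    obtain M where M: "\<And>s. s \<in> {0..t} \<Longrightarrow> norm (w s) \<le> M"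
      using compact_imp_bounded[OF compact_continuous_image[OF cw compact_Icc]]
      unfolding bounded_iff by blast
    have "(v has_vector_derivative (1/2) *\<^sub>R w s) (at_right s)" if "0 \<le> s" for s
      using ext.has_vector_derivative[OF semigroup_right_derivative[OF T fg that]]
      unfolding v_def w_def by (simp add: ext.scaleR)
    then have "apply_bcontfun (v t) x = heat t (apply_bcontfun (v 0)) x"
      using E M cv \<open>t \<ge> 0\<close>
      by (intro heat_representation[of t v w M E])
         (auto simp: w_def intro!: uniformly_continuous_extend[OF \<sigma>])
    then show ?thesis
      using \<open>x \<ge> 0\<close> by (simp add: v_def semigroup_zero[OF T] extend_apply reflect_extend_def)
  qed
  obtain F where F: "\<And>n. F n \<in> Domain (generator T)" and lim: "F \<longlonglongrightarrow> f"
    using generator_domain_dense[OF T, of f] unfolding closure_sequential by blast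
  have lip: "\<bar>heat t (apply_bcontfun h) x - heat t (apply_bcontfun k) x\<bar> \<le> norm (h - k)" for h k
  proof -
    have "heat t (apply_bcontfun h) x - heat t (apply_bcontfun k) x
        = heat t (\<lambda>y. apply_bcontfun h y - apply_bcontfun k y) x"
      by (subst heat_diff[OF _ bcontfun_abs_le _ bcontfun_abs_le]) auto
    also have "\<dots> = heat t (apply_bcontfun (h - k)) x"
      by simp
    finally show ?thesis
      by (simp only: abs_heat_le[OF bcontfun_measurable bcontfun_abs_le])
  qed
  have "(\<lambda>n. heat t (apply_bcontfun (extend a \<sigma> (F n))) x) \<longlonglongrightarrow> heat t (apply_bcontfun (extend a \<sigma> f)) x"
  proof (rule LIM_zero_cancel, rule Lim_null_comparison)
    show "\<forall>\<^sub>F n in sequentially. norm (heat t (apply_bcontfun (extend a \<sigma> (F n))) x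
        - heat t (apply_bcontfun (extend a \<sigma> f)) x) \<le> norm (extend a \<sigma> (F n) - extend a \<sigma> f)"
      using lip by simp
    show "(\<lambda>n. norm (extend a \<sigma> (F n) - extend a \<sigma> f)) \<longlonglongrightarrow> 0"
      by (intro tendsto_norm_zero LIM_zero ext.tendsto lim)
  qed
  moreover have "(\<lambda>n. cext_apply (T t (F n)) (\<sigma> * x)) \<longlonglongrightarrow> cext_apply (T t f) (\<sigma> * x)"
  proof (rule LIM_zero_cancel, rule Lim_null_comparison)
    show "\<forall>\<^sub>F n in sequentially. norm (cext_apply (T t (F n)) (\<sigma> * x) - cext_apply (T t f) (\<sigma> * x))
        \<le> norm (T t (F n) - T t f)"
      using cext_apply_abs_le[of "T t (F _) - T t f" "\<sigma> * x"] by (intro always_eventually allI) simp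
    show "(\<lambda>n. norm (T t (F n) - T t f)) \<longlonglongrightarrow> 0"
      by (intro tendsto_norm_zero LIM_zero blinfun.tendsto lim tendsto_const)
  qed
  moreover have "cext_apply (T t (F n)) (\<sigma> * x) = heat t (apply_bcontfun (extend a \<sigma> (F n))) x" for n
    using F[of n] dom by blast
  ultimately have "cext_apply (T t f) (\<sigma> * x) = heat t (apply_bcontfun (extend a \<sigma> f)) x"
    by (simp add: LIMSEQ_unique)
  then show ?thesis
    by (simp only: extend_apply)
qed

section \<open>The kernels and the transition laws\<close>

lemma has_bochner_integral_lborel_mirror:
  fixes f :: "real \<Rightarrow> real"
  assumes "has_bochner_integral lborel f I"
  shows "has_bochner_integral lborel (\<lambda>y. f (- y)) I"
  using assms lborel_has_bochner_integral_real_affine_iff[of "-1" f I 0] by simp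

lemma heat_has_bochner_integral:
  assumes "t > 0" and [measurable]: "g \<in> borel_measurable borel" and "\<And>y. \<bar>g y\<bar> \<le> B"
  shows "has_bochner_integral lborel (\<lambda>y. normal_density x (sqrt t) y * g y) (heat t g x)"
proof -
  let ?N = "density lborel (normal_density 0 (sqrt t))"
  interpret N: prob_space ?N
    using \<open>t > 0\<close> by (intro prob_space_normal_density) auto
  have "integrable ?N (\<lambda>y. g (x + y))"
    by (rule N.integrable_const_bound[of _ B]) (use assms in auto)
  then have "has_bochner_integral lborel (\<lambda>y. normal_density 0 (sqrt t) y * g (x + y)) (heat t g x)"
    using \<open>t > 0\<close>
    by (simp add: heat_eq_density has_bochner_integral_iff integrable_density integral_density normal_density_nonneg)
  then show ?thesis
    using lborel_has_bochner_integral_real_affine_iff[of 1 "\<lambda>y. normal_density x (sqrt t) y * g y" "heat t g x" x]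
    by (simp add: normal_density_def)
qed

text \<open>The reflected part of the extension, supported on \<open>y < 0\<close>, is exchanged for
  its mirror image on \<open>y > 0\<close>. The integral is unchanged, and \<open>n (- y)\<close>
  becomes the term with \<open>(y + x)\<^sup>2\<close>.\<close>

lemma gamma_plus_has_bochner_integral:
  assumes "t > 0" "p + q > 0" and F [measurable]: "F \<in> borel_measurable borel" and B: "\<And>y. \<bar>F y\<bar> \<le> B"
  shows "has_bochner_integral lborel (\<lambda>y. gamma_plus p q t x y * F y)
    (heat t (reflect_extend ((p - q) / (p + q)) F) x)"
proof -
  define a where "a = (p - q) / (p + q)"
  define n where "n = normal_density x (sqrt t)"
  define Q where "Q y = n y * (indicator {..<0} y * a * F (- y))" for y
  have [measurable]: "n \<in> borel_measurable borel" "Q \<in> borel_measurable borel"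
    unfolding Q_def n_def by measurable
  have [measurable]: "reflect_extend a F \<in> borel_measurable borel"
    unfolding reflect_extend_def[abs_def] by measurable
  have "has_bochner_integral lborel (\<lambda>y. n y * reflect_extend a F y) (heat t (reflect_extend a F) x)"
    unfolding n_def using \<open>t > 0\<close> reflect_extend_abs_le[OF B]
    by (intro heat_has_bochner_integral) auto
  moreover have "has_bochner_integral lborel Q (heat t (\<lambda>y. indicator {..<0} y * a * F (- y)) x)"
    unfolding n_def Q_def
  proof (rule heat_has_bochner_integral[OF \<open>t > 0\<close>])
    fix y show "\<bar>indicator {..<0} y * a * F (- y)\<bar> \<le> \<bar>a\<bar> * B"
      using B[of "- y"] order_trans[OF abs_ge_zero B[of 0]]
      by (auto simp: abs_mult mult_left_mono split: split_indicator)
  qed measurable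
  \<comment> \<open>\<open>Q\<close> and its mirror image have the same integral, so subtracting one
    and adding the other leaves the total fixed.\<close>
  ultimately have "has_bochner_integral lborel (\<lambda>y. n y * reflect_extend a F y - Q y + Q (- y))
      (heat t (reflect_extend a F) x)"
    using has_bochner_integral_add[OF has_bochner_integral_diff has_bochner_integral_lborel_mirror] by force
  \<comment> \<open>The point 0 is left out because \<open>gamma_plus\<close> is set to zero
    there.\<close>
  moreover have "AE y in lborel. n y * reflect_extend a F y - Q y + Q (- y) = gamma_plus p q t x y * F y"
    using AE_lborel_singleton[of "0::real"]
  proof eventually_elim
    case (elim y)
    have a: "1 - a = 2 * q / (p + q)"
      using \<open>p + q > 0\<close> by (simp add: a_def field_simps)
    have n: "1 / sqrt (2 * pi * t) * exp (- ((y - x)\<^sup>2 / (2 * t))) = n y"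
      "1 / sqrt (2 * pi * t) * exp (- ((y + x)\<^sup>2 / (2 * t))) = n (- y)"
      using \<open>t > 0\<close> power2_minus[of "y + x"] by (simp_all add: n_def normal_density_def)
    have "gamma_plus p q t x y = (if y > 0 then n y + a * n (- y) else if y < 0 then (1 - a) * n y else 0)"
      unfolding gamma_plus_def n[symmetric] a unfolding a_def by (simp add: distrib_left mult_ac)
    then show ?case
      using elim by (auto simp: reflect_extend_def Q_def algebra_simps)
  qed
  ultimately show ?thesis
    unfolding a_def[symmetric]
    by (subst (asm) has_bochner_integral_cong_AE) (auto simp: gamma_plus_def)
qed

section \<open>From expectations to densities\<close>

text \<open>A continuous step from 1 at \<open>x\<close> to 0 at \<open>y\<close> lies between the
  indicators of the half-lines up to \<open>x\<close> and up to \<open>y\<close>. Hence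
  \<open>cdf M x \<le> cdf N y\<close>, and letting \<open>y\<close> decrease to \<open>x\<close>
  uses right continuity; the converse is symmetric.\<close>

lemma real_distribution_eqI_cts_step:
  assumes M: "real_distribution M" and N: "real_distribution N"
    and eq: "\<And>x y. x < y \<Longrightarrow> integral\<^sup>L M (cts_step x y) = integral\<^sup>L N (cts_step x y)"
  shows "M = N"
proof -
  have le: "cdf M x \<le> cdf N x" if "real_distribution M" "real_distribution N"
    "\<And>x y. x < y \<Longrightarrow> integral\<^sup>L M (cts_step x y) = integral\<^sup>L N (cts_step x y)" for M N x
  proof -
    interpret M: real_distribution M by fact
    interpret N: real_distribution N by fact
    have "(cdf N \<longlongrightarrow> cdf N x) (at_right x)"
      using N.cdf_is_right_cont[of x] by (simp add: continuous_within)
    moreover have "\<forall>\<^sub>F y in at_right x. cdf M x \<le> cdf N y"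
      using eventually_at_right_less[of x]
    proof eventually_elim
      case (elim y)
      then show ?case using M.cdf_cts_step(1)[of x y] N.cdf_cts_step(2)[of x y] that(3)[of x y] by simp
    qed
    ultimately show ?thesis
      by (rule tendsto_lowerbound) simp
  qed
  have "cdf M = cdf N"
    by (intro ext antisym le M N eq eq[symmetric])
  then show ?thesis by (rule cdf_unique[OF M N])
qed

text \<open>Steps have limits 1 and 0 at the two infinities, so they are admissible test functions
  for the semigroup.\<close>

lemma cts_step_cext:
  assumes "x < y"
  obtains f where "cext_apply f = cts_step x y"
proof -
  have "(cts_step x y \<longlongrightarrow> 0) at_top"
  proof (rule Lim_transform_eventually[OF tendsto_const])
    show "\<forall>\<^sub>F z in at_top. 0 = cts_step x y z"
      using eventually_ge_at_top[of y] by eventually_elim (use assms in \<open>simp add: cts_step_def\<close>)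
  qed
  moreover have "(cts_step x y \<longlongrightarrow> 1) at_bot"
  proof (rule Lim_transform_eventually[OF tendsto_const])
    show "\<forall>\<^sub>F z in at_bot. 1 = cts_step x y z"
      using eventually_le_at_bot[of x] by eventually_elim (simp add: cts_step_def)
  qed
  ultimately show ?thesis
    using cext_exists that uniformly_continuous_imp_continuous[OF cts_step_uniformly_continuous[OF assms]]
    by blast
qed

lemma distributed_if_expectations:
  assumes "prob_space M" and [measurable]: "X \<in> borel_measurable M" "\<gamma> \<in> borel_measurable borel"
    and pos: "\<And>y. \<gamma> y \<ge> 0"
    and expect: "\<And>f. has_bochner_integral lborel (\<lambda>y. \<gamma> y * cext_apply f y) (\<integral>\<omega>. cext_apply f (X \<omega>) \<partial>M)"
  shows "distributed M lborel X (\<lambda>y. ennreal (\<gamma> y))"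
proof -
  interpret M: prob_space M by fact
  \<comment> \<open>The constant function 1 as test function shows that the density has total mass
    1.\<close>
  obtain u where u: "cext_apply u = (\<lambda>_. 1)"
    using cext_exists[OF continuous_on_const tendsto_const tendsto_const] .
  have "has_bochner_integral lborel \<gamma> 1"
    using expect[of u] by (simp add: u M.prob_space)
  then have "emeasure (density lborel \<gamma>) UNIV = 1"
    by (simp add: emeasure_density has_bochner_integral_iff nn_integral_eq_integral pos)
  then have \<gamma>: "real_distribution (density lborel \<gamma>)"
    by (auto simp: real_distribution_def real_distribution_axioms_def intro!: prob_spaceI)
  have "distr M borel X = density lborel \<gamma>"
  proof (rule real_distribution_eqI_cts_step[OF _ \<gamma>])
    show "real_distribution (distr M borel X)"
      by (rule M.real_distribution_distr) measurable
    fix x y :: real assume "x < y"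
    then obtain f where f: "cext_apply f = cts_step x y" by (rule cts_step_cext)
    have [measurable]: "cts_step x y \<in> borel_measurable borel"
      unfolding f[symmetric] by measurable
    show "integral\<^sup>L (distr M borel X) (cts_step x y) = integral\<^sup>L (density lborel \<gamma>) (cts_step x y)"
      using expect[of f] by (simp add: f integral_distr integral_density pos has_bochner_integral_iff)
  qed
  moreover have "distr M lborel X = distr M borel X"
    by (rule distr_cong) auto
  ultimately show ?thesis
    unfolding distributed_def by simp
qed

lemma gamma_plus_measurable [measurable]: "gamma_plus p q t x \<in> borel_measurable borel"
  unfolding gamma_plus_def[abs_def] by measurable

text \<open>For \<open>x\<close> and \<open>y\<close> positive, \<open>y\<close> is at least as
  close to \<open>x\<close> as to \<open>- x\<close>, so the reflected Gaussian is the smaller one;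
  its coefficient is at least -1.\<close>

lemma gamma_plus_nonneg:
  assumes "p \<ge> 0" "q \<ge> 0" "p + q > 0" "t > 0" "x > 0"
  shows "gamma_plus p q t x y \<ge> 0"
proof -
  have "exp (- ((y - x)\<^sup>2 / (2 * t))) + (p - q) / (p + q) * exp (- ((y + x)\<^sup>2 / (2 * t))) \<ge> 0" if "y > 0"
  proof -
    have "(y - x)\<^sup>2 \<le> (y + x)\<^sup>2"
      using that \<open>x > 0\<close> by (simp add: power2_eq_square algebra_simps)
    then have "exp (- ((y + x)\<^sup>2 / (2 * t))) \<le> exp (- ((y - x)\<^sup>2 / (2 * t)))"
      using \<open>t > 0\<close> by (simp add: divide_right_mono)
    moreover have "- 1 \<le> (p - q) / (p + q)"
      using assms by (simp add: field_simps)
    then have "- 1 * exp (- ((y + x)\<^sup>2 / (2 * t))) \<le> (p - q) / (p + q) * exp (- ((y + x)\<^sup>2 / (2 * t)))"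
      by (rule mult_right_mono) simp
    ultimately show ?thesis by linarith
  qed
  then show ?thesis
    using assms by (simp add: gamma_plus_def)
qed

text \<open>Valid at \<open>y = 0\<close> too, since both kernels were given the value zero
  there.\<close>

lemma gamma_minus_eq_mirror: "gamma_minus p q t x y = gamma_plus q p t (- x) (- y)"
  by (simp add: gamma_minus_def gamma_plus_def power2_commute add.commute)

section \<open>Both half-lines and the transition densities\<close>

theorem mainTheorem5:
  fixes p q :: real
    and T :: "real \<Rightarrow> cext \<Rightarrow>\<^sub>L cext"
  assumes "p \<ge> 0" and "q \<ge> 0" and "p + q > 0"
    and "generates (scale_operator (1/2) (delta_star p q)) T"
  shows "(\<forall>f. \<forall>t>0.
            (\<forall>x>0. has_bochner_integral lborel (\<lambda>y. gamma_plus p q t x y * cext_apply f y)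
                     (cext_apply (blinfun_apply (T t) f) x)) \<and>
            (\<forall>x<0. has_bochner_integral lborel (\<lambda>y. gamma_minus p q t x y * cext_apply f y)
                     (cext_apply (blinfun_apply (T t) f) x))) \<and>
         (\<forall>(P :: real \<Rightarrow> 'w measure) w. governed_by P w T \<longrightarrow>
            (\<forall>t>0.
              (\<forall>x>0. distributed (P x) lborel (w t) (\<lambda>y. ennreal (gamma_plus p q t x y))) \<and>
              (\<forall>x<0. distributed (P x) lborel (w t) (\<lambda>y. ennreal (gamma_minus p q t x y)))))"
proof -
  have T: "strongly_continuous_semigroup T" and gen: "generator T = scale_operator (1/2) (delta_star p q)"
    using assms(4) by (auto simp: generates_def)
  have trans: "transmission_C2 p q (cext_apply f) (\<lambda>y. 2 * cext_apply g y)" if "(f, g) \<in> generator T" for f g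
  proof -
    have "(f, 2 *\<^sub>R g) \<in> delta_star p q"
      using that unfolding gen scale_operator_def by auto
    moreover have "cext_apply (2 *\<^sub>R g) = (\<lambda>y. 2 * cext_apply g y)"
      by (rule ext) simp
    ultimately show ?thesis
      using delta_star_transmission_C2 by metis
  qed
  have plus: "has_bochner_integral lborel (\<lambda>y. gamma_plus p q t x y * cext_apply f y) (cext_apply (T t f) x)"
    if "t > 0" "x > 0" for f t x
  proof -
    have "cext_apply (T t f) (1 * x)
        = heat t (reflect_extend ((p - q) / (p + q)) (\<lambda>y. cext_apply f (1 * y))) x"
      using trans assms(3) that by (intro semigroup_eq_heat[OF T]) auto
    then show ?thesis
      using gamma_plus_has_bochner_integral[OF that(1) assms(3) cext_apply_measurable cext_apply_abs_le] by simp
  qed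
  have minus: "has_bochner_integral lborel (\<lambda>y. gamma_minus p q t x y * cext_apply f y) (cext_apply (T t f) x)"
    if "t > 0" "x < 0" for f t x
  proof -
    \<comment> \<open>The case \<sigma> = -1 at the positive point \<open>- x\<close>, with
      \<open>p\<close> and \<open>q\<close> exchanged; the substitution of \<open>- y\<close> for
      \<open>y\<close> then turns the kernel into \<open>gamma_minus\<close>.\<close>
    have "cext_apply (T t f) (- 1 * - x)
        = heat t (reflect_extend ((q - p) / (q + p)) (\<lambda>y. cext_apply f (- 1 * y))) (- x)"
      using transmission_C2_mirror[OF trans] assms(3) that by (intro semigroup_eq_heat[OF T]) auto
    moreover have "has_bochner_integral lborel (\<lambda>y. gamma_plus q p t (- x) y * cext_apply f (- y))
        (heat t (reflect_extend ((q - p) / (q + p)) (\<lambda>y. cext_apply f (- y))) (- x))"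
      using assms(3) that by (intro gamma_plus_has_bochner_integral[OF _ _ _ cext_apply_abs_le]) auto
    ultimately show ?thesis
      using has_bochner_integral_lborel_mirror by (fastforce simp: gamma_minus_eq_mirror)
  qed
  \<comment> \<open>The governing relation identifies the expectation of
    \<open>cext_apply f (w t \<omega>)\<close> with the value of \<open>T t f\<close> at the
    starting point, and the kernel integrals represent that value for every
    \<open>f\<close>.\<close>
  have dist: "distributed (P x) lborel (w t) (\<lambda>y. ennreal (\<gamma> y))"
    if gov: "governed_by P w T" and "t > 0" and "\<gamma> \<in> borel_measurable borel" "\<And>y. \<gamma> y \<ge> 0"
      and \<gamma>: "\<And>f. has_bochner_integral lborel (\<lambda>y. \<gamma> y * cext_apply f y) (cext_apply (T t f) x)"
    for P :: "real \<Rightarrow> 'w measure" and w t x \<gamma>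
  proof (rule distributed_if_expectations)
    show "prob_space (P x)" "w t \<in> borel_measurable (P x)"
      using gov \<open>t > 0\<close> by (auto simp: governed_by_def markov_process_def)
    show "has_bochner_integral lborel (\<lambda>y. \<gamma> y * cext_apply f y) (\<integral>\<omega>. cext_apply f (w t \<omega>) \<partial>P x)" for f
      using gov \<open>t > 0\<close> \<gamma>[of f] by (simp add: governed_by_def)
  qed fact+
  have [measurable]: "gamma_minus p q t x \<in> borel_measurable borel" for t x
    unfolding gamma_minus_eq_mirror[abs_def] by measurable
  have "gamma_minus p q t x y \<ge> 0" if "t > 0" "x < 0" for t x y
    unfolding gamma_minus_eq_mirror using assms that by (intro gamma_plus_nonneg) auto
  then show ?thesis
    using plus minus dist gamma_plus_nonneg[OF assms(1-3)] by simp
qed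

end
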